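(* For every constant $d$, the problem $d$-Set Packing($k$) admits a logspace kernelization that runs in time $O(|\mathcal{F}|^{d+2})$ and returns an equivalent instance with at most $(d(k-1)+1)^d$ sets.
   Context: $d$-Set Packing($k$): given a finite set $U$, a family $\mathcal{F}$ of subsets of $U$ each of size at most $d$, and $k \in \mathbb{N}$ (the parameter), decide whether there is a subfamily $\mathcal{P} \subseteq \mathcal{F}$ of $k$ pairwise disjoint sets. A kernelization for a parameterized problem is an algorithm that, given an instance $(x,k)$, computes in time polynomial in $|x|+k$ an instance $(x',k')$ with $|x'|+k' \leq g(k)$ for some computable $g$ such that $(x,k)$ is a yes-instance iff $(x',k')$ is a yes-instance (an equivalent instance). A logspace kernelization is a kernelization that uses only logarithmic working space (read-only input, write-only output). *)

theory Defs
  imports Main "HOL-Library.Log_Nat"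
begin

(* Machine model: a unit-cost random access machine whose input is a read-only array of
   words, whose output is an append-only sequence of words, and whose working memory is the
   finite set of registers named in its program.  Space is the total bit length of these
   registers; input positions are only available through registers, so they are paid for.
   If the space is logarithmic, every instruction works on words of logarithmically many bits,
   so unit cost is the usual word-RAM measure. *)

datatype instr =
    Const nat nat         \<comment> \<open>register, constant\<close>
  | Move nat nat          \<comment> \<open>target, source\<close>
  | Add nat nat nat       \<comment> \<open>target, operands; likewise for the next two\<close>
  | Sub nat nat nat       \<comment> \<open>truncated subtraction\<close>
  | Mul nat nat nat
  | Read nat nat          \<comment> \<open>target, register holding an input position\<close>
  | Write nat
  | Jump nat              \<comment> \<open>label\<close>
  | Jump_less nat nat nat \<comment> \<open>operands, label\<close>

type_synonym program = "instr list"

record config =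
  pc :: nat
  regs :: "nat \<Rightarrow> nat"
  out_tape :: "nat list"

definition init_config :: config where
  "init_config = \<lparr>pc = 0, regs = (\<lambda>_. 0), out_tape = []\<rparr>"

fun exec_instr :: "nat list \<Rightarrow> instr \<Rightarrow> config \<Rightarrow> config" where
  "exec_instr w (Const r n) c = c\<lparr>pc := pc c + 1, regs := (regs c)(r := n)\<rparr>"
| "exec_instr w (Move r a) c = c\<lparr>pc := pc c + 1, regs := (regs c)(r := regs c a)\<rparr>"
| "exec_instr w (Add r a b) c =
     c\<lparr>pc := pc c + 1, regs := (regs c)(r := regs c a + regs c b)\<rparr>"
| "exec_instr w (Sub r a b) c =
     c\<lparr>pc := pc c + 1, regs := (regs c)(r := regs c a - regs c b)\<rparr>"
| "exec_instr w (Mul r a b) c =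
     c\<lparr>pc := pc c + 1, regs := (regs c)(r := regs c a * regs c b)\<rparr>"
| "exec_instr w (Read r a) c =
     c\<lparr>pc := pc c + 1,
       regs := (regs c)(r := (if regs c a < length w then w ! regs c a else 0))\<rparr>"
| "exec_instr w (Write a) c = c\<lparr>pc := pc c + 1, out_tape := out_tape c @ [regs c a]\<rparr>"
| "exec_instr w (Jump l) c = c\<lparr>pc := l\<rparr>"
| "exec_instr w (Jump_less a b l) c =
     c\<lparr>pc := (if regs c a < regs c b then l else pc c + 1)\<rparr>"

definition halted :: "program \<Rightarrow> config \<Rightarrow> bool" where
  "halted P c \<longleftrightarrow> length P \<le> pc c"

definition step :: "program \<Rightarrow> nat list \<Rightarrow> config \<Rightarrow> config" where
  "step P w c = (if halted P c then c else exec_instr w (P ! pc c) c)"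

definition run :: "program \<Rightarrow> nat list \<Rightarrow> nat \<Rightarrow> config" where
  "run P w t = (step P w ^^ t) init_config"

definition halts_within :: "program \<Rightarrow> nat list \<Rightarrow> nat \<Rightarrow> bool" where
  "halts_within P w t \<longleftrightarrow> halted P (run P w t)"

definition computes :: "program \<Rightarrow> nat list \<Rightarrow> nat list \<Rightarrow> bool" where
  "computes P w y \<longleftrightarrow> (\<exists>t. halted P (run P w t) \<and> out_tape (run P w t) = y)"

definition bit_size :: "nat \<Rightarrow> nat" where
  "bit_size n = max 1 (floorlog 2 n)"

definition word_list_size :: "nat list \<Rightarrow> nat" where
  "word_list_size x = sum_list (map bit_size x)"

fun instr_regs :: "instr \<Rightarrow> nat set" where
  "instr_regs (Const r n) = {r}"
| "instr_regs (Move r a) = {r, a}"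
| "instr_regs (Add r a b) = {r, a, b}"
| "instr_regs (Sub r a b) = {r, a, b}"
| "instr_regs (Mul r a b) = {r, a, b}"
| "instr_regs (Read r a) = {r, a}"
| "instr_regs (Write a) = {a}"
| "instr_regs (Jump l) = {}"
| "instr_regs (Jump_less a b l) = {a, b}"

definition space :: "program \<Rightarrow> config \<Rightarrow> nat" where
  "space P c = (\<Sum>r\<in>(\<Union>i\<in>set P. instr_regs i). bit_size (regs c r))"

(* Multiplication and conditional jumps on unbounded registers make the machines Turing
   complete, so this is the standard notion of a (total) computable function. *)
definition computable :: "(nat \<Rightarrow> nat) \<Rightarrow> bool" where
  "computable g \<longleftrightarrow> (\<exists>P. \<forall>k. computes P [k] [g k])"


(* Instances are abstract objects paired with the parameter; machines see an encoding of the
   object as a list of words, preceded by the parameter.  An object may have many encodings. *)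

record 'i parameterized_problem =
  instances :: "('i \<times> nat) set"
  yes_instances :: "('i \<times> nat) set"
  encodes :: "nat list \<Rightarrow> 'i \<Rightarrow> bool"

definition kernelization :: "program \<Rightarrow> 'i parameterized_problem \<Rightarrow> bool" where
  "kernelization P Q \<longleftrightarrow>
     (\<exists>g c e. computable g \<and>
        (\<forall>i k x. (i, k) \<in> instances Q \<longrightarrow> encodes Q x i \<longrightarrow>
           halts_within P (k # x) (c * (word_list_size x + k) ^ e + c) \<and>
           (\<exists>i' k' x'. computes P (k # x) (k' # x') \<and>
              (i', k') \<in> instances Q \<and> encodes Q x' i' \<and>
              word_list_size x' + k' \<le> g k \<and>
              ((i, k) \<in> yes_instances Q \<longleftrightarrow> (i', k') \<in> yes_instances Q))))"

definition logspace_kernelization :: "program \<Rightarrow> 'i parameterized_problem \<Rightarrow> bool" where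
  "logspace_kernelization P Q \<longleftrightarrow>
     kernelization P Q \<and>
     (\<exists>c. \<forall>i k x t. (i, k) \<in> instances Q \<longrightarrow> encodes Q x i \<longrightarrow>
        space P (run P (k # x) t) \<le> c * bit_size (word_list_size x + k))"


definition has_packing :: "'a set set \<Rightarrow> nat \<Rightarrow> bool" where
  "has_packing F k \<longleftrightarrow> (\<exists>\<P>\<subseteq>F. finite \<P> \<and> card \<P> = k \<and> pairwise disjnt \<P>)"

(* us lists the universe, and its elements are referred to by their positions in us, i.e. by
   the words 0, ..., |U| - 1.  All of these words are part of the encoding, so that its size is
   at least |U| even if the family leaves elements uncovered.  Every set of the family is
   listed once, in any order, preceded by its cardinality and with its elements in any order. *)
definition encodes_set_family :: "nat list \<Rightarrow> 'a set \<times> 'a set set \<Rightarrow> bool" where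
  "encodes_set_family x = (\<lambda>(U, F). \<exists>us Ss.
     distinct us \<and> set us = U \<and>
     (\<forall>S\<in>set Ss. distinct S \<and> set S \<subseteq> {..<length us}) \<and>
     distinct (map set Ss) \<and>
     F = (\<lambda>S. (!) us ` set S) ` set Ss \<and>
     x = length us # [0..<length us] @ length Ss # concat (map (\<lambda>S. length S # S) Ss))"

definition set_packing :: "nat \<Rightarrow> ('a set \<times> 'a set set) parameterized_problem" where
  "set_packing d =
     \<lparr>instances = {((U, F), k). finite U \<and> F \<subseteq> Pow U \<and> (\<forall>S\<in>F. card S \<le> d)},
      yes_instances = {((U, F), k). finite U \<and> F \<subseteq> Pow U \<and> (\<forall>S\<in>F. card S \<le> d) \<and>
                                    has_packing F k},
      encodes = encodes_set_family\<rparr>"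

end

theory Submission
  imports Defs "HOL-Library.Countable"
begin

text \<open>Put \<open>b = d (k - 1) + 1\<close>.  In level \<open>l + 1\<close> a set of level \<open>l\<close> survives unless it contains some \<open>C\<close>
  of size \<open>d - l - 1\<close> that is contained in at least \<open>b ^ (l + 1)\<close> preceding sets of level \<open>l\<close>.  Every set of
  size \<open>d - l\<close> is contained in at most \<open>b ^ l\<close> sets of level \<open>l\<close>, so the at most \<open>d (k - 1)\<close> elements of the
  other members of a packing meet fewer than \<open>b ^ (l + 1)\<close> of those preceding sets, and a removed
  member of a packing can be replaced.  At most \<open>b ^ d\<close> sets reach level \<open>d\<close>.

  Membership in level \<open>l + 1\<close> is decided in logarithmic space by constantly many passes over the
  family that recursively decide membership in level \<open>l\<close>, which takes time \<open>O(|F| ^ d)\<close> for level \<open>d\<close>.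
  Listing the surviving sets and renaming their elements costs two more factors \<open>|F|\<close>.\<close>


section \<open>Executions\<close>

text \<open>The space bound needs polynomially bounded registers at every moment, although the
  machine can square a register in one step. All multiplications are therefore confined to a
  straight-line prelude whose length depends on \<open>d\<close> only and which computes the powers
  of \<open>b\<close>. The rest is compiled from a loop language that can only add constants, so the
  bound on the registers grows by at most 1 per step and the running time controls it.

  The time bound mentions |F| but not |U|. The words that list U are therefore jumped over and never
  scanned, and the elements of the kept sets receive new names. A table of names does not fit into
  logarithmic space, so a name is given by a formula: \<open>d\<close> times the number of kept sets
  before the last one that contains the element, plus the place of the element in that set. It is
  recomputed for every occurrence. Names that no element receives stay in the output universe, which
  is therefore an initial segment of the natural numbers and can be written without knowing which
  names occur.\<close>

definition steps_within :: "program \<Rightarrow> nat list \<Rightarrow> nat \<Rightarrow> config \<Rightarrow> config \<Rightarrow> bool" where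
  "steps_within P w T c c' \<longleftrightarrow> (\<exists>t\<le>T. (step P w ^^ t) c = c')"

lemma steps_within_refl: "steps_within P w T c c"
  by (auto simp: steps_within_def intro!: exI[of _ 0])

lemma steps_within_eq: "c = c' \<Longrightarrow> steps_within P w T c c'"
  by (simp add: steps_within_refl)

lemma steps_within_trans:
  assumes "steps_within P w T c c'" "steps_within P w T' c' c''"
  shows "steps_within P w (T + T') c c''"
proof -
  from assms obtain t t' where "t \<le> T" "(step P w ^^ t) c = c'" "t' \<le> T'" "(step P w ^^ t') c' = c''"
    by (auto simp: steps_within_def)
  then have "t' + t \<le> T + T'" "(step P w ^^ (t' + t)) c = c''"
    by (auto simp: funpow_add)
  then show ?thesis unfolding steps_within_def by blast
qed

lemma steps_within_mono: "steps_within P w T c c' \<Longrightarrow> T \<le> T' \<Longrightarrow> steps_within P w T' c c'"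
  by (auto simp: steps_within_def intro: order_trans)

text \<open>Jump labels are absolute, so a fragment is reasoned about at its address inside the
  whole program and not as a program of its own.\<close>

definition code_at :: "program \<Rightarrow> nat \<Rightarrow> program \<Rightarrow> bool" where
  "code_at P a is \<longleftrightarrow> (\<forall>j<length is. a + j < length P \<and> P ! (a + j) = is ! j)"

lemma code_at_Nil [simp]: "code_at P a []"
  by (simp add: code_at_def)

lemma code_at_Cons [simp]:
  "code_at P a (i # is) \<longleftrightarrow> a < length P \<and> P ! a = i \<and> code_at P (Suc a) is"
  by (auto simp: code_at_def less_Suc_eq_0_disj all_conj_distrib)

lemma code_at_append [simp]:
  "code_at P a (is @ js) \<longleftrightarrow> code_at P a is \<and> code_at P (a + length is) js"
  by (induction "is" arbitrary: a) auto

lemma code_at_middle: "code_at (as @ is @ bs) (length as) is"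
  by (auto simp: code_at_def nth_append)

lemma steps_within_step:
  assumes "pc c < length P" "steps_within P w T (exec_instr w (P ! pc c) c) c'"
  shows "steps_within P w (Suc T) c c'"
proof -
  from assms(2) obtain t where "t \<le> T" "(step P w ^^ t) (exec_instr w (P ! pc c) c) = c'"
    by (auto simp: steps_within_def)
  then have "Suc t \<le> Suc T \<and> (step P w ^^ Suc t) c = c'"
    using assms(1) by (simp only: funpow_Suc_right) (simp add: step_def halted_def)
  then show ?thesis unfolding steps_within_def by blast
qed

lemma steps_within_instr:
  assumes "pc c < length P" "c' = exec_instr w (P ! pc c) c"
  shows "steps_within P w (Suc 0) c c'"
  using steps_within_step[OF assms(1), of w 0 c'] assms(2) steps_within_refl by simp

lemma halted_stays:
  assumes "halted P (run P w t)" "t \<le> t'"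
  shows "run P w t' = run P w t"
proof -
  have "(step P w ^^ m) c = c" if "halted P c" for m c
    using that by (induction m) (auto simp: step_def)
  moreover have "run P w t' = (step P w ^^ (t' - t)) (run P w t)"
    using assms(2) unfolding run_def
    by (metis comp_apply funpow_add le_add_diff_inverse2)
  ultimately show ?thesis using assms(1) by simp
qed

definition fetch :: "nat list \<Rightarrow> nat \<Rightarrow> nat" where
  "fetch w p = (if p < length w then w ! p else 0)"


section \<open>A loop language and its compilation\<close>

text \<open>There is no sum of two variables and no product. Adding a constant compiles to that many
  increments, which keeps the growth of registers additive.\<close>

datatype 'v exp = Num nat | Plus 'v nat | Rd 'v nat

datatype 'v bexp = Less "'v exp" "'v exp" | BNot "'v bexp" | BAnd "'v bexp" "'v bexp"

datatype 'v com =
    Skip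
  | Set 'v "'v exp"
  | Out "'v exp"
  | Seq "'v com" "'v com"
  | If "'v bexp" "'v com" "'v com"
  | For "'v com"

type_synonym 'v state = "('v \<Rightarrow> nat) \<times> nat list"

fun aval :: "nat list \<Rightarrow> 'v exp \<Rightarrow> ('v \<Rightarrow> nat) \<Rightarrow> nat" where
  "aval w (Num m) v = m"
| "aval w (Plus x m) v = v x + m"
| "aval w (Rd x m) v = fetch w (v x + m)"

fun bval :: "nat list \<Rightarrow> 'v bexp \<Rightarrow> ('v \<Rightarrow> nat) \<Rightarrow> bool" where
  "bval w (Less e e') v \<longleftrightarrow> aval w e v < aval w e' v"
| "bval w (BNot b) v \<longleftrightarrow> \<not> bval w b v"
| "bval w (BAnd b b') v \<longleftrightarrow> bval w b v \<and> bval w b' v"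

text \<open>All loops of a program make the same number \<open>n\<close> of iterations.  This makes the
  semantics total and the running time a function of the program text and \<open>n\<close> only.\<close>

fun sem :: "nat list \<Rightarrow> nat \<Rightarrow> 'v com \<Rightarrow> 'v state \<Rightarrow> 'v state" where
  "sem w n Skip s = s"
| "sem w n (Set x e) s = ((fst s)(x := aval w e (fst s)), snd s)"
| "sem w n (Out e) s = (fst s, snd s @ [aval w e (fst s)])"
| "sem w n (Seq c c') s = sem w n c' (sem w n c s)"
| "sem w n (If b c c') s = (if bval w b (fst s) then sem w n c s else sem w n c' s)"
| "sem w n (For c) s = (sem w n c ^^ n) s"

text \<open>Variables live in the even registers.  Of the odd ones, register 1 holds the constant 1,
  register 3 the number of iterations, and the others form a stack of temporaries and loop
  counters.\<close>

definition reg :: "'v :: countable \<Rightarrow> nat" where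
  "reg x = 2 * to_nat x"

definition scratch :: "nat \<Rightarrow> nat" where
  "scratch h = 2 * h + 1"

lemma reg_simps [simp]:
  "reg x = reg y \<longleftrightarrow> x = y" "reg x \<noteq> scratch h" "scratch h \<noteq> reg x"
  "reg x \<noteq> Suc 0" "Suc 0 \<noteq> reg x" "reg x \<noteq> 3" "3 \<noteq> reg x"
  unfolding reg_def scratch_def by (auto simp: inj_eq) presburger+

lemma scratch_simps [simp]:
  "scratch h = scratch h' \<longleftrightarrow> h = h'" "scratch h = Suc 0 \<longleftrightarrow> h = 0" "scratch h = 3 \<longleftrightarrow> h = 1"
  "Suc 0 = scratch h \<longleftrightarrow> h = 0" "3 = scratch h \<longleftrightarrow> h = 1"
  unfolding scratch_def by auto

fun comp_exp :: "nat \<Rightarrow> 'v :: countable exp \<Rightarrow> program" where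
  "comp_exp r (Num m) = [Const r m]"
| "comp_exp r (Plus x m) = Move r (reg x) # replicate m (Add r r 1)"
| "comp_exp r (Rd x m) = Move r (reg x) # replicate m (Add r r 1) @ [Read r r]"

text \<open>Truth values are 0 and 1 in \<open>scratch h\<close>. Negation subtracts from 1, and
  conjunction takes the minimum of two values that are both always evaluated.\<close>

fun comp_bexp :: "nat \<Rightarrow> nat \<Rightarrow> 'v :: countable bexp \<Rightarrow> program" where
  "comp_bexp a h (Less e e') =
     (let is = comp_exp (scratch h) e @ comp_exp (scratch (Suc h)) e'; p = a + length is in
      is @ [Jump_less (scratch h) (scratch (Suc h)) (p + 3), Const (scratch h) 0,
            Jump (p + 4), Const (scratch h) 1])"
| "comp_bexp a h (BNot b) =
     comp_bexp a h b @ [Const (scratch (Suc h)) 1, Sub (scratch h) (scratch (Suc h)) (scratch h)]"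
| "comp_bexp a h (BAnd b b') =
     (let is = comp_bexp a h b; js = comp_bexp (a + length is) (Suc h) b';
          p = a + length is + length js in
      is @ js @ [Jump_less (scratch h) (scratch (Suc h)) (p + 2),
                 Move (scratch h) (scratch (Suc h))])"

text \<open>A loop keeps its counter in \<open>scratch h\<close> and its body uses higher
  temporaries only. No jump goes below the start address \<open>a\<close>, so control never returns
  to code placed before it.\<close>

fun comp :: "nat \<Rightarrow> nat \<Rightarrow> 'v :: countable com \<Rightarrow> program" where
  "comp a h Skip = []"
| "comp a h (Set x e) = comp_exp (scratch h) e @ [Move (reg x) (scratch h)]"
| "comp a h (Out e) = comp_exp (scratch h) e @ [Write (scratch h)]"
| "comp a h (Seq c c') = (let is = comp a h c in is @ comp (a + length is) h c')"
| "comp a h (If b c c') =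
     (let is = comp_bexp a h b; js = comp (a + length is + 2) h c';
          q = a + length is + 2 + length js + 1; ks = comp q h c in
      is @ [Const (scratch (Suc h)) 0, Jump_less (scratch (Suc h)) (scratch h) q] @
      js @ [Jump (q + length ks)] @ ks)"
| "comp a h (For c) =
     (let is = comp (a + 3) (Suc h) c in
      [Const (scratch h) 0, Jump_less (scratch h) 3 (a + 3), Jump (a + length is + 5)] @
      is @ [Add (scratch h) (scratch h) 1, Jump (a + 1)])"

section \<open>Running time of loop programs\<close>

fun exp_time :: "'v exp \<Rightarrow> nat" where
  "exp_time (Num m) = 1"
| "exp_time (Plus x m) = 1 + m"
| "exp_time (Rd x m) = 2 + m"

fun bexp_time :: "'v bexp \<Rightarrow> nat" where
  "bexp_time (Less e e') = exp_time e + exp_time e' + 3"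
| "bexp_time (BNot b) = bexp_time b + 2"
| "bexp_time (BAnd b b') = bexp_time b + bexp_time b' + 2"

text \<open>A conditional is charged for both branches, so the bound does not depend on the
  data.\<close>

fun com_time :: "nat \<Rightarrow> 'v com \<Rightarrow> nat" where
  "com_time n Skip = 0"
| "com_time n (Set x e) = exp_time e + 1"
| "com_time n (Out e) = exp_time e + 1"
| "com_time n (Seq c c') = com_time n c + com_time n c'"
| "com_time n (If b c c') = bexp_time b + com_time n c + com_time n c' + 3"
| "com_time n (For c) = n * (com_time n c + 3) + 3"

fun degree :: "'v com \<Rightarrow> nat" where
  "degree (Seq c c') = max (degree c) (degree c')"
| "degree (If b c c') = max (degree c) (degree c')"
| "degree (For c) = Suc (degree c)"
| "degree _ = 0"

text \<open>Each level of loop nesting costs one factor \<open>n\<close>, all else a constant. The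
  base is \<open>max 1 n\<close> because constant time is spent even when no loop iterates.\<close>

lemma com_time_le: "\<exists>K. \<forall>n. com_time n c \<le> K * max 1 n ^ degree c"
proof (induction c)
  case (Seq c c')
  then obtain K K' where K: "\<And>n. com_time n c \<le> K * max 1 n ^ degree c"
    "\<And>n. com_time n c' \<le> K' * max 1 n ^ degree c'" by blast
  have "com_time n (Seq c c') \<le> (K + K') * max 1 n ^ max (degree c) (degree c')" for n
  proof -
    have "K * max 1 n ^ degree c \<le> K * max 1 n ^ max (degree c) (degree c')"
      "K' * max 1 n ^ degree c' \<le> K' * max 1 n ^ max (degree c) (degree c')"
      by (intro mult_left_mono power_increasing; simp)+
    with K[of n] show ?thesis unfolding add_mult_distrib com_time.simps by linarith
  qed
  then show ?case by auto
next
  case (If b c c')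
  then obtain K K' where K: "\<And>n. com_time n c \<le> K * max 1 n ^ degree c"
    "\<And>n. com_time n c' \<le> K' * max 1 n ^ degree c'" by blast
  have "com_time n (If b c c') \<le>
      (K + K' + (bexp_time b + 3)) * max 1 n ^ max (degree c) (degree c')" for n
  proof -
    have "K * max 1 n ^ degree c \<le> K * max 1 n ^ max (degree c) (degree c')"
      "K' * max 1 n ^ degree c' \<le> K' * max 1 n ^ max (degree c) (degree c')"
      by (intro mult_left_mono power_increasing; simp)+
    moreover have "(bexp_time b + 3) * 1 \<le> (bexp_time b + 3) * max 1 n ^ max (degree c) (degree c')"
      by (intro mult_left_mono one_le_power) auto
    ultimately show ?thesis using K[of n] unfolding add_mult_distrib com_time.simps by linarith
  qed
  then show ?case by auto
next
  case (For c)
  then obtain K where K: "\<And>n. com_time n c \<le> K * max 1 n ^ degree c" by blast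
  have "com_time n (For c) \<le> (K + 6) * max 1 n ^ Suc (degree c)" for n
  proof -
    have "com_time n c + 3 \<le> (K + 3) * max 1 n ^ degree c"
      using K[of n] one_le_power[of "max 1 n" "degree c"] unfolding add_mult_distrib by linarith
    then have "n * (com_time n c + 3) \<le> max 1 n * ((K + 3) * max 1 n ^ degree c)"
      by (intro mult_mono) auto
    moreover have "3 * 1 \<le> 3 * max 1 n ^ Suc (degree c)"
      by (intro mult_left_mono one_le_power) auto
    moreover have "a * ((K + 3) * p) + 3 * (a * p) = (K + 6) * (a * p)" for a p :: nat
      by (simp add: algebra_simps)
    ultimately show ?thesis unfolding com_time.simps degree.simps power_Suc
      by (metis add_mono mult.right_neutral)
  qed
  then show ?case by auto
qed auto

section \<open>Simulation of loop programs by the machine\<close>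

definition represents :: "nat \<Rightarrow> 'v :: countable state \<Rightarrow> config \<Rightarrow> bool" where
  "represents n s c \<longleftrightarrow>
     (\<forall>x. regs c (reg x) = fst s x) \<and> regs c 1 = 1 \<and> regs c 3 = n \<and> out_tape c = snd s"

text \<open>Temporaries below \<open>h\<close> hold values of enclosing constructs, such as loop
  counters and left operands, and must survive. Compilation starts at height 2 because
  \<open>scratch 0\<close> and \<open>scratch 1\<close> are the reserved registers 1 and 3.\<close>

definition same_below :: "nat \<Rightarrow> config \<Rightarrow> config \<Rightarrow> bool" where
  "same_below h c c' \<longleftrightarrow> (\<forall>h'<h. regs c' (scratch h') = regs c (scratch h'))"

lemma same_below_trans: "same_below h c c' \<Longrightarrow> same_below h c' c'' \<Longrightarrow> same_below h c c''"
  by (simp add: same_below_def)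

lemma same_below_mono: "same_below h c c' \<Longrightarrow> h' \<le> h \<Longrightarrow> same_below h' c c'"
  by (simp add: same_below_def)

lemma same_below_refl [simp]: "same_below h c c"
  by (simp add: same_below_def)

lemma same_belowD: "same_below h c c' \<Longrightarrow> h' < h \<Longrightarrow> regs c' (scratch h') = regs c (scratch h')"
  by (simp add: same_below_def)

lemma represents_upd [simp]:
  "2 \<le> h \<Longrightarrow> represents n s (c\<lparr>pc := p, regs := (regs c)(scratch h := m)\<rparr>) \<longleftrightarrow> represents n s c"
  "represents n s (c\<lparr>pc := p\<rparr>) \<longleftrightarrow> represents n s c"
  by (auto simp: represents_def)

lemma same_below_upd [simp]:
  "h \<le> h' \<Longrightarrow> same_below h c0 (c\<lparr>pc := p, regs := (regs c)(scratch h' := m)\<rparr>) \<longleftrightarrow> same_below h c0 c"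
  "same_below h c0 (c\<lparr>pc := p\<rparr>) \<longleftrightarrow> same_below h c0 c"
  "same_below h c0 (c\<lparr>pc := p, regs := (regs c)(reg x := m)\<rparr>) \<longleftrightarrow> same_below h c0 c"
  "same_below h c0 (c\<lparr>pc := p, out_tape := ys\<rparr>) \<longleftrightarrow> same_below h c0 c"
  by (auto simp: same_below_def)

lemma adds_correct:
  assumes "code_at P (pc c) (replicate m (Add r r 1))" "regs c 1 = 1" "r \<noteq> 1"
  shows "steps_within P w m c (c\<lparr>pc := pc c + m, regs := (regs c)(r := regs c r + m)\<rparr>)"
  using assms
proof (induction m arbitrary: c)
  case 0
  then show ?case by (simp add: steps_within_refl)
next
  case (Suc m)
  let ?c = "c\<lparr>pc := pc c + 1, regs := (regs c)(r := regs c r + 1)\<rparr>"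
  have "steps_within P w m ?c
      (?c\<lparr>pc := pc ?c + m, regs := (regs ?c)(r := regs ?c r + m)\<rparr>)"
    using Suc.prems by (intro Suc.IH) auto
  then show ?case
    using Suc.prems by (intro steps_within_step) (auto simp: fun_upd_def if_distrib cong: if_cong)
qed

lemma comp_exp_correct:
  assumes "code_at P (pc c) (comp_exp (scratch h) e)" "represents n s c" "2 \<le> h"
  shows "steps_within P w (exp_time e) c
     (c\<lparr>pc := pc c + length (comp_exp (scratch h) e),
        regs := (regs c)(scratch h := aval w e (fst s))\<rparr>)"
proof -
  have 1: "regs c 1 = 1" and v: "\<And>x. regs c (reg x) = fst s x"
    using assms(2) by (auto simp: represents_def)
  have off: "steps_within P w (1 + m) c (c\<lparr>pc := pc c + Suc m,
        regs := (regs c)(scratch h := fst s x + m)\<rparr>)"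
    if "code_at P (pc c) (Move (scratch h) (reg x) # replicate m (Add (scratch h) (scratch h) 1))"
    for x m
  proof -
    let ?c = "c\<lparr>pc := pc c + 1, regs := (regs c)(scratch h := fst s x)\<rparr>"
    have "steps_within P w m ?c (?c\<lparr>pc := pc ?c + m,
        regs := (regs ?c)(scratch h := regs ?c (scratch h) + m)\<rparr>)"
      using that 1 assms(3) by (intro adds_correct) auto
    then show ?thesis
      using that v unfolding plus_1_eq_Suc by (intro steps_within_step) auto
  qed
  show ?thesis
  proof (cases e)
    case (Num m)
    then show ?thesis using assms(1)
      by (auto intro!: steps_within_instr)
  next
    case (Plus x m)
    then show ?thesis using off[of x m] assms(1) by simp
  next
    case (Rd x m)
    have "steps_within P w (1 + m + 1) c (c\<lparr>pc := pc c + Suc (Suc m),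
        regs := (regs c)(scratch h := aval w e (fst s))\<rparr>)"
      using assms(1) Rd
      by (intro steps_within_trans[OF off[of x m]])
        (auto intro!: steps_within_instr simp: fetch_def)
    then show ?thesis using Rd by simp
  qed
qed

lemma comp_bexp_correct:
  assumes "code_at P (pc c) (comp_bexp (pc c) h b)" "represents n s c" "2 \<le> h"
  shows "\<exists>c'. steps_within P w (bexp_time b) c c' \<and>
     pc c' = pc c + length (comp_bexp (pc c) h b) \<and> represents n s c' \<and> same_below h c c' \<and>
     regs c' (scratch h) = of_bool (bval w b (fst s))"
  using assms
proof (induction b arbitrary: c h)
  case (Less e e')
  let ?is = "comp_exp (scratch h) e" and ?js = "comp_exp (scratch (Suc h)) e'"
  let ?p = "pc c + length ?is + length ?js"
  let ?c1 = "c\<lparr>pc := pc c + length ?is, regs := (regs c)(scratch h := aval w e (fst s))\<rparr>"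
  let ?c2 = "?c1\<lparr>pc := ?p, regs := (regs ?c1)(scratch (Suc h) := aval w e' (fst s))\<rparr>"
  let ?c3 = "?c2\<lparr>pc := ?p + 4, regs := (regs ?c2)(scratch h := of_bool (bval w (Less e e') (fst s)))\<rparr>"
  have code: "code_at P (pc c) ?is" "code_at P (pc c + length ?is) ?js"
    "code_at P ?p [Jump_less (scratch h) (scratch (Suc h)) (?p + 3), Const (scratch h) 0,
            Jump (?p + 4), Const (scratch h) 1]"
    using Less.prems(1) by (simp_all add: Let_def add.assoc)
  have 1: "steps_within P w (exp_time e) c ?c1"
    using code Less.prems by (intro comp_exp_correct)
  have r1: "represents n s ?c1" using Less.prems by simp
  have 2: "steps_within P w (exp_time e') ?c1 ?c2"
    using comp_exp_correct[of P ?c1 "Suc h" e' n s w] code(2) Less.prems(3) r1 by simp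
  have 3: "steps_within P w 3 ?c2 ?c3"
    unfolding numeral_3_eq_3
    apply (rule steps_within_step)
    subgoal using code(3) by simp
    apply (cases "bval w (Less e e') (fst s)")
    subgoal using code(3)
      apply (intro steps_within_mono[OF steps_within_instr])
      by (simp_all add: eval_nat_numeral)
    subgoal using code(3)
      apply (intro steps_within_step)
        apply (simp_all add: eval_nat_numeral)
      by (rule steps_within_eq) simp
    done
  have "steps_within P w (exp_time e + exp_time e' + 3) c ?c3"
    by (rule steps_within_trans[OF steps_within_trans[OF 1 2] 3])
  moreover have "represents n s ?c3" using r1 Less.prems(3) by (subst represents_upd | simp)+
  moreover have "same_below h c ?c3" by (auto simp: same_below_def)
  ultimately show ?case
    by (intro exI[of _ ?c3]) (auto simp: Let_def)
next
  case (BNot b)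
  from BNot.IH[of c h] BNot.prems obtain c1 where
    c1: "steps_within P w (bexp_time b) c c1" "pc c1 = pc c + length (comp_bexp (pc c) h b)"
    "represents n s c1" "same_below h c c1" "regs c1 (scratch h) = of_bool (bval w b (fst s))"
    by auto
  let ?c2 = "c1\<lparr>pc := pc c1 + 1, regs := (regs c1)(scratch (Suc h) := 1)\<rparr>"
  let ?c3 = "?c2\<lparr>pc := pc ?c2 + 1, regs := (regs ?c2)(scratch h := 1 - of_bool (bval w b (fst s)))\<rparr>"
  have "steps_within P w 2 c1 ?c3"
    unfolding numeral_2_eq_2
    using BNot.prems c1 by (intro steps_within_step) (auto simp: steps_within_refl)
  then have "steps_within P w (bexp_time b + 2) c ?c3"
    by (rule steps_within_trans[OF c1(1)])
  moreover have "represents n s ?c3" using c1 BNot.prems(3) by (subst represents_upd | simp)+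
  moreover have "same_below h c ?c3" using c1 by (subst same_below_upd | simp)+
  ultimately show ?case using c1(2)
    by (intro exI[of _ ?c3]) auto
next
  case (BAnd b b')
  let ?is = "comp_bexp (pc c) h b"
  let ?js = "comp_bexp (pc c + length ?is) (Suc h) b'"
  let ?p = "pc c + length ?is + length ?js"
  have code: "code_at P (pc c) ?is" "code_at P (pc c + length ?is) ?js"
    "code_at P ?p [Jump_less (scratch h) (scratch (Suc h)) (?p + 2),
       Move (scratch h) (scratch (Suc h))]"
    using BAnd.prems(1) by (simp_all add: Let_def add.assoc)
  from BAnd.IH(1)[of c h] BAnd.prems code obtain c1 where
    c1: "steps_within P w (bexp_time b) c c1" "pc c1 = pc c + length ?is"
    "represents n s c1" "same_below h c c1" "regs c1 (scratch h) = of_bool (bval w b (fst s))"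
    by auto
  from BAnd.IH(2)[of c1 "Suc h"] BAnd.prems code c1 obtain c2 where
    c2: "steps_within P w (bexp_time b') c1 c2" "pc c2 = ?p"
    "represents n s c2" "same_below (Suc h) c1 c2"
    "regs c2 (scratch (Suc h)) = of_bool (bval w b' (fst s))"
    by auto
  have eq: "regs c2 (scratch h) = of_bool (bval w b (fst s))"
    using c1(5) same_belowD[OF c2(4), of h] by simp
  let ?c3 = "c2\<lparr>pc := ?p + 2, regs := (regs c2)(scratch h := of_bool (bval w (BAnd b b') (fst s)))\<rparr>"
  have 3: "steps_within P w 2 c2 ?c3"
    unfolding numeral_2_eq_2
    apply (rule steps_within_step)
    subgoal using code(3) c2(2) by simp
    apply (cases "regs c2 (scratch h) < regs c2 (scratch (Suc h))")
    subgoal using code(3) c2 eq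
      by (intro steps_within_eq config.equality) (auto split: if_splits)
    subgoal using code(3) c2 eq
      by (auto intro!: steps_within_instr split: if_splits)
    done
  have "steps_within P w (bexp_time b + bexp_time b' + 2) c ?c3"
    by (rule steps_within_trans[OF steps_within_trans[OF c1(1) c2(1)] 3])
  moreover have "represents n s ?c3" using c2(3) BAnd.prems(3) by (subst represents_upd | simp)+
  moreover have "same_below h c ?c3"
    using same_below_trans[OF c1(4) same_below_mono[OF c2(4)]] by simp
  ultimately show ?case
    by (intro exI[of _ ?c3]) (auto simp: Let_def)
qed


text \<open>Induction on the number \<open>m\<close> of remaining iterations, the counter being
  \<open>n - m\<close>. Per iteration the overhead is the test, the increment and the jump back; the
  final 2 steps are the failing test and the exit jump.\<close>

lemma comp_loop_correct:
  fixes f :: "'v :: countable state \<Rightarrow> 'v state"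
  assumes body: "\<And>c s. pc c = a + 3 \<Longrightarrow> represents n s c \<Longrightarrow>
      \<exists>c'. steps_within P w T c c' \<and> pc c' = a + 3 + l \<and>
        represents n (f s) c' \<and> same_below (Suc h) c c'"
    and code: "code_at P (Suc a) [Jump_less (scratch h) 3 (a + 3), Jump (a + l + 5)]"
      "code_at P (a + 3 + l) [Add (scratch h) (scratch h) 1, Jump (a + 1)]"
    and "2 \<le> h" "regs c (scratch h) + m = n" "pc c = a + 1" "represents n s c"
  shows "\<exists>c'. steps_within P w (m * (T + 3) + 2) c c' \<and> pc c' = a + l + 5 \<and>
    represents n ((f ^^ m) s) c' \<and> same_below h c c'"
  using assms(5-)
proof (induction m arbitrary: c s)
  case 0
  let ?c = "c\<lparr>pc := a + l + 5\<rparr>"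
  have [simp]: "regs c 3 = n" using 0 by (simp add: represents_def)
  have "steps_within P w 2 c ?c"
    unfolding numeral_2_eq_2
    using 0 code(1) by (intro steps_within_step) (auto intro: steps_within_eq)
  then show ?case using 0 by (intro exI[of _ ?c]) (auto simp: numeral_2_eq_2)
next
  case (Suc m)
  let ?c1 = "c\<lparr>pc := a + 3\<rparr>"
  have [simp]: "regs c 3 = n" using Suc.prems by (simp add: represents_def)
  have 1: "steps_within P w 1 c ?c1"
    using Suc.prems code(1) by (auto intro!: steps_within_instr)
  obtain c2 where c2: "steps_within P w T ?c1 c2" "pc c2 = a + 3 + l"
    "represents n (f s) c2" "same_below (Suc h) ?c1 c2"
    using body[of ?c1 s] Suc.prems by auto
  have [simp]: "regs c2 1 = 1" using c2(3) by (simp add: represents_def)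
  let ?c3 = "c2\<lparr>pc := a + 1, regs := (regs c2)(scratch h := regs c (scratch h) + 1)\<rparr>"
  have eq: "regs c2 (scratch h) = regs c (scratch h)"
    using same_belowD[OF c2(4), of h] by simp
  have 3: "steps_within P w 2 c2 ?c3"
    unfolding numeral_2_eq_2
    using c2(2) eq code(2) \<open>regs c2 1 = 1\<close>
    by (intro steps_within_step) (auto intro: steps_within_eq)
  obtain c4 where c4: "steps_within P w (m * (T + 3) + 2) ?c3 c4" "pc c4 = a + l + 5"
    "represents n ((f ^^ m) (f s)) c4" "same_below h ?c3 c4"
    using Suc.IH[of ?c3 "f s"] Suc.prems c2(3) \<open>2 \<le> h\<close> by auto
  have "same_below h c c4"
    using c2(4) c4(4) by (auto simp: same_below_def)
  moreover have "steps_within P w (Suc m * (T + 3) + 2) c c4"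
    using steps_within_trans[OF steps_within_trans[OF steps_within_trans[OF 1 c2(1)] 3] c4(1)]
    by (elim steps_within_mono) simp
  ultimately show ?case using c4 by (intro exI[of _ c4]) (auto simp: funpow_swap1)
qed

lemma comp_correct:
  assumes "code_at P (pc c) (comp (pc c) h p)" "represents n s c" "2 \<le> h"
  shows "\<exists>c'. steps_within P w (com_time n p) c c' \<and>
     pc c' = pc c + length (comp (pc c) h p) \<and> represents n (sem w n p s) c' \<and> same_below h c c'"
  using assms
proof (induction p arbitrary: c h s)
  case Skip
  then show ?case by (intro exI[of _ c]) (auto simp: steps_within_refl)
next
  case (Set x e)
  let ?is = "comp_exp (scratch h) e"
  let ?c1 = "c\<lparr>pc := pc c + length ?is, regs := (regs c)(scratch h := aval w e (fst s))\<rparr>"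
  let ?c2 = "?c1\<lparr>pc := pc ?c1 + 1, regs := (regs ?c1)(reg x := aval w e (fst s))\<rparr>"
  have "steps_within P w (exp_time e) c ?c1"
    using Set.prems by (intro comp_exp_correct) auto
  moreover have "steps_within P w 1 ?c1 ?c2"
    using Set.prems by (auto intro!: steps_within_instr)
  ultimately have "steps_within P w (exp_time e + 1) c ?c2"
    by (rule steps_within_trans)
  moreover have "represents n (sem w n (Set x e) s) ?c2" "same_below h c ?c2"
    using Set.prems by (auto simp: represents_def same_below_def)
  ultimately show ?case by (intro exI[of _ ?c2]) auto
next
  case (Out e)
  let ?is = "comp_exp (scratch h) e"
  let ?c1 = "c\<lparr>pc := pc c + length ?is, regs := (regs c)(scratch h := aval w e (fst s))\<rparr>"
  let ?c2 = "?c1\<lparr>pc := pc ?c1 + 1, out_tape := out_tape ?c1 @ [aval w e (fst s)]\<rparr>"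
  have "steps_within P w (exp_time e) c ?c1"
    using Out.prems by (intro comp_exp_correct) auto
  moreover have "steps_within P w 1 ?c1 ?c2"
    using Out.prems by (auto intro!: steps_within_instr)
  ultimately have "steps_within P w (exp_time e + 1) c ?c2"
    by (rule steps_within_trans)
  moreover have "represents n (sem w n (Out e) s) ?c2" "same_below h c ?c2"
    using Out.prems by (auto simp: represents_def same_below_def)
  ultimately show ?case by (intro exI[of _ ?c2]) auto
next
  case (Seq p q)
  obtain c1 where c1: "steps_within P w (com_time n p) c c1"
     "pc c1 = pc c + length (comp (pc c) h p)" "represents n (sem w n p s) c1" "same_below h c c1"
    using Seq.IH(1)[of c h s] Seq.prems by (auto simp: Let_def)
  obtain c2 where c2: "steps_within P w (com_time n q) c1 c2"
     "pc c2 = pc c1 + length (comp (pc c1) h q)"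
     "represents n (sem w n q (sem w n p s)) c2" "same_below h c1 c2"
    using Seq.IH(2)[of c1 h "sem w n p s"] Seq.prems c1 by (auto simp: Let_def)
  show ?case
    using steps_within_trans[OF c1(1) c2(1)] same_below_trans[OF c1(4) c2(4)] c1(2) c2(2,3)
    by (intro exI[of _ c2]) (auto simp: Let_def)
next
  case (If b p q)
  let ?is = "comp_bexp (pc c) h b"
  let ?js = "comp (pc c + length ?is + 2) h q"
  let ?q = "pc c + length ?is + 2 + length ?js + 1"
  let ?ks = "comp ?q h p"
  have code: "code_at P (pc c) ?is"
    "code_at P (pc c + length ?is)
       [Const (scratch (Suc h)) 0, Jump_less (scratch (Suc h)) (scratch h) ?q]"
    "code_at P (pc c + length ?is + 2) ?js"
    "code_at P (pc c + length ?is + 2 + length ?js) [Jump (?q + length ?ks)]"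
    "code_at P ?q ?ks"
    using If.prems(1) by (simp_all add: Let_def)
  have len: "pc c + length (comp (pc c) h (If b p q)) = ?q + length ?ks"
    by (simp add: Let_def)
  obtain c1 where c1: "steps_within P w (bexp_time b) c c1" "pc c1 = pc c + length ?is"
    "represents n s c1" "same_below h c c1" "regs c1 (scratch h) = of_bool (bval w b (fst s))"
    using comp_bexp_correct[of P c h b n s w] If.prems code(1) by auto
  let ?c2 = "c1\<lparr>pc := if bval w b (fst s) then ?q else pc c + length ?is + 2,
    regs := (regs c1)(scratch (Suc h) := 0)\<rparr>"
  have 2: "steps_within P w 2 c1 ?c2"
    unfolding numeral_2_eq_2
    using c1 code(2) by (intro steps_within_step) (auto intro: steps_within_eq)
  have 12: "steps_within P w (bexp_time b + 2) c ?c2"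
    by (rule steps_within_trans[OF c1(1) 2])
  have r2: "represents n s ?c2" "same_below h c ?c2"
    using c1 If.prems(3) by (subst represents_upd same_below_upd; simp)+
  show ?case
  proof (cases "bval w b (fst s)")
    case True
    obtain c3 where c3: "steps_within P w (com_time n p) ?c2 c3"
      "pc c3 = ?q + length ?ks" "represents n (sem w n p s) c3" "same_below h ?c2 c3"
      using If.IH(1)[of ?c2 h s] If.prems(3) code(5) r2 True by auto
    have "steps_within P w (com_time n (If b p q)) c c3"
      using steps_within_trans[OF 12 c3(1)] by (elim steps_within_mono) simp
    then show ?thesis
      using same_below_trans[OF r2(2) c3(4)] c3 True unfolding len by (intro exI[of _ c3]) auto
  next
    case False
    obtain c3 where c3: "steps_within P w (com_time n q) ?c2 c3"
      "pc c3 = pc c + length ?is + 2 + length ?js"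
      "represents n (sem w n q s) c3" "same_below h ?c2 c3"
      using If.IH(2)[of ?c2 h s] If.prems(3) code(3) r2 False by auto
    let ?c4 = "c3\<lparr>pc := ?q + length ?ks\<rparr>"
    have 4: "steps_within P w 1 c3 ?c4"
      using c3(2) code(4) by (auto intro!: steps_within_instr)
    have "steps_within P w (com_time n (If b p q)) c ?c4"
      using steps_within_trans[OF steps_within_trans[OF 12 c3(1)] 4]
      by (elim steps_within_mono) simp
    then show ?thesis
      using same_below_trans[OF r2(2) c3(4)] c3 False unfolding len
      by (intro exI[of _ ?c4]) auto
  qed
next
  case (For p)
  let ?is = "comp (pc c + 3) (Suc h) p"
  let ?c1 = "c\<lparr>pc := pc c + 1, regs := (regs c)(scratch h := 0)\<rparr>"
  have code: "code_at P (pc c) [Const (scratch h) 0]"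
    "code_at P (Suc (pc c)) [Jump_less (scratch h) 3 (pc c + 3), Jump (pc c + length ?is + 5)]"
    "code_at P (pc c + 3) ?is"
    "code_at P (pc c + 3 + length ?is) [Add (scratch h) (scratch h) 1, Jump (pc c + 1)]"
    using For.prems(1) by (simp_all add: Let_def eval_nat_numeral)
  have 1: "steps_within P w 1 c ?c1"
    using code(1) by (auto intro!: steps_within_instr)
  have "\<exists>c'. steps_within P w (n * (com_time n p + 3) + 2) ?c1 c' \<and>
    pc c' = pc c + length ?is + 5 \<and> represents n ((sem w n p ^^ n) s) c' \<and> same_below h ?c1 c'"
  proof (rule comp_loop_correct)
    fix c' and s :: "'a state" assume "pc c' = pc c + 3" "represents n s c'"
    then show "\<exists>c''. steps_within P w (com_time n p) c' c'' \<and> pc c'' = pc c + 3 + length ?is \<and>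
        represents n (sem w n p s) c'' \<and> same_below (Suc h) c' c''"
      using For.IH[of c' "Suc h" s] code(3) For.prems(3) by auto
  qed (use code For.prems in auto)
  then obtain c2 where c2: "steps_within P w (n * (com_time n p + 3) + 2) ?c1 c2"
    "pc c2 = pc c + length ?is + 5" "represents n ((sem w n p ^^ n) s) c2" "same_below h ?c1 c2"
    by blast
  have "steps_within P w (com_time n (For p)) c c2"
    using steps_within_trans[OF 1 c2(1)] by (elim steps_within_mono) simp
  moreover have "same_below h c c2" using c2(4) by (auto simp: same_below_def)
  ultimately show ?case using c2 by (intro exI[of _ c2]) (auto simp: Let_def)
qed


section \<open>Size of the register contents\<close>

lemma step_bound_square:
  assumes "\<forall>r. regs c r \<le> m" "2 \<le> m" "\<forall>x\<in>set w. x \<le> m" "\<forall>r a. Const r a \<in> set P \<longrightarrow> a \<le> m"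
  shows "regs (step P w c) r \<le> m * m"
proof (cases "halted P c")
  case True
  have "regs c r \<le> m * m" using assms(1,2) by (meson le_square order_trans)
  with True show ?thesis by (simp add: step_def)
next
  case False
  then have i: "P ! pc c \<in> set P" by (simp add: halted_def)
  have m: "a \<le> m \<Longrightarrow> a \<le> m * m" for a using le_square order_trans by blast
  have "regs c a + regs c b \<le> m * m" for a b
  proof -
    have "regs c a + regs c b \<le> 2 * m" using assms(1) by (metis add_mono mult_2)
    also have "\<dots> \<le> m * m" using assms(2) by simp
    finally show ?thesis .
  qed
  moreover have "regs c a * regs c b \<le> m * m" for a b using assms(1) by (simp add: mult_mono)
  moreover have "regs c a - regs c b \<le> m * m" for a b
    using assms(1) by (meson diff_le_self m order_trans)
  ultimately show ?thesis
    using False i assms by (cases "P ! pc c") (auto simp: step_def intro!: m)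
qed

text \<open>One multiplication can square the largest value. The doubly exponential bound is
  harmless for the prelude: its length depends on \<open>d\<close> alone, so the bound is polynomial
  in \<open>m\<close>.\<close>

lemma run_bound_power:
  assumes "2 \<le> m" "\<forall>x\<in>set w. x \<le> m" "\<forall>r a. Const r a \<in> set P \<longrightarrow> a \<le> m"
  shows "regs (run P w t) r \<le> m ^ 2 ^ t"
proof (induction t arbitrary: r)
  case 0
  then show ?case by (simp add: run_def init_config_def)
next
  case (Suc t)
  have m: "m \<le> m ^ 2 ^ t" using assms(1) by (simp add: self_le_power)
  have "regs (step P w (run P w t)) r \<le> m ^ 2 ^ t * m ^ 2 ^ t"
    using Suc.IH assms order_trans[OF _ m] by (intro step_bound_square) (blast | simp)+
  then show ?case by (simp add: run_def mult_2 power_add)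
qed

text \<open>The operand 1 of \<open>Add\<close> is register 1, which holds 1 and may not be
  overwritten, so every addition is an increment. Reads are bounded by the input words, and
  truncated subtraction never enlarges a value. Jumps stay at or above \<open>p\<close>, away from
  multiplications placed before it.\<close>

fun incremental :: "nat \<Rightarrow> instr \<Rightarrow> bool" where
  "incremental p (Const r a) \<longleftrightarrow> r \<noteq> 1"
| "incremental p (Move r a) \<longleftrightarrow> r \<noteq> 1"
| "incremental p (Add r a b) \<longleftrightarrow> r \<noteq> 1 \<and> b = 1"
| "incremental p (Sub r a b) \<longleftrightarrow> r \<noteq> 1"
| "incremental p (Mul r a b) \<longleftrightarrow> False"
| "incremental p (Read r a) \<longleftrightarrow> r \<noteq> 1"
| "incremental p (Write a) \<longleftrightarrow> True"
| "incremental p (Jump l) \<longleftrightarrow> p \<le> l"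
| "incremental p (Jump_less a b l) \<longleftrightarrow> p \<le> l"

lemma step_bound_incremental:
  assumes "\<forall>q. p \<le> q \<longrightarrow> q < length P \<longrightarrow> incremental p (P ! q)"
    "p \<le> pc c" "regs c 1 = 1" "\<forall>r. regs c r \<le> m"
    "\<forall>x\<in>set w. x \<le> m" "\<forall>r a. Const r a \<in> set P \<longrightarrow> a \<le> m"
  shows "p \<le> pc (step P w c)" "regs (step P w c) 1 = 1" "regs (step P w c) r \<le> Suc m"
proof -
  have "p \<le> pc (step P w c) \<and> regs (step P w c) 1 = 1 \<and> regs (step P w c) r \<le> Suc m"
  proof (cases "halted P c")
    case False
    then have "P ! pc c \<in> set P" "incremental p (P ! pc c)"
      using assms(1,2) by (auto simp: halted_def)
    moreover have "regs c a - regs c b \<le> Suc m" for a b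
      using assms(4) by (meson diff_le_self le_SucI order_trans)
    ultimately show ?thesis
      by (cases "P ! pc c" rule: instr.exhaust) (use False assms(2-) in \<open>auto simp: step_def intro!: le_SucI\<close>)
  qed (use assms in \<open>auto simp: step_def intro: le_SucI\<close>)
  then show "p \<le> pc (step P w c)" "regs (step P w c) 1 = 1" "regs (step P w c) r \<le> Suc m"
    by auto
qed

lemma run_bound_incremental:
  assumes "\<forall>q. p \<le> q \<longrightarrow> q < length P \<longrightarrow> incremental p (P ! q)"
    "p \<le> pc c" "regs c 1 = 1" "\<forall>r. regs c r \<le> m"
    "\<forall>x\<in>set w. x \<le> m" "\<forall>r a. Const r a \<in> set P \<longrightarrow> a \<le> m"
  shows "regs ((step P w ^^ t) c) r \<le> m + t"
proof -
  have "p \<le> pc ((step P w ^^ t) c) \<and> regs ((step P w ^^ t) c) 1 = 1 \<and>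
    (\<forall>r. regs ((step P w ^^ t) c) r \<le> m + t)"
  proof (induction t)
    case (Suc t)
    have w: "\<forall>x\<in>set w. x \<le> m + t" "\<forall>r a. Const r a \<in> set P \<longrightarrow> a \<le> m + t"
      using assms by (auto intro: trans_le_add1)
    show ?case using step_bound_incremental[OF assms(1) _ _ _ w] Suc by simp
  qed (use assms in auto)
  then show ?thesis by blast
qed

lemma incremental_mono: "incremental q i \<Longrightarrow> p \<le> q \<Longrightarrow> incremental p i"
  by (cases i) auto

lemma incremental_comp_exp: "1 \<le> h \<Longrightarrow> i \<in> set (comp_exp (scratch h) e) \<Longrightarrow> incremental p i"
  by (cases e) auto

lemma incremental_comp_bexp:
  "1 \<le> h \<Longrightarrow> i \<in> set (comp_bexp a h b) \<Longrightarrow> incremental a i"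
proof (induction b arbitrary: a h)
  case (Less e e')
  then show ?case
    using incremental_comp_exp[of h i e a] incremental_comp_exp[of "Suc h" i e' a]
    by (auto simp: Let_def)
next
  case (BAnd b b')
  then show ?case
    using BAnd.IH(1)[of h a] BAnd.IH(2)[of "Suc h" "a + length (comp_bexp a h b)"]
    by (auto simp: Let_def intro: incremental_mono)
qed auto

lemma incremental_comp: "1 \<le> h \<Longrightarrow> i \<in> set (comp a h p) \<Longrightarrow> incremental a i"
proof (induction p arbitrary: a h)
  case (Seq p q)
  then show ?case
    using Seq.IH(1)[of h a] incremental_mono[OF Seq.IH(2)[of h "a + length (comp a h p)"], of a]
    by (auto simp: Let_def)
next
  case (If b p q)
  let ?q = "a + length (comp_bexp a h b) + 2"
  let ?p = "?q + length (comp ?q h q) + 1"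
  show ?case
    using If.prems If.IH(1)[of h ?p] If.IH(2)[of h ?q] incremental_comp_bexp[of h i a b]
    by (auto simp: Let_def intro: incremental_mono)
next
  case (For p)
  then show ?case using For.IH[of "Suc h" "a + 3"]
    by (auto simp: Let_def intro: incremental_mono)
qed (use incremental_comp_exp in auto)


section \<open>Packings\<close>

lemma has_packing_mono: "has_packing G k \<Longrightarrow> G \<subseteq> G' \<Longrightarrow> has_packing G' k"
  unfolding has_packing_def by blast

text \<open>Used twice: to pass from elements of the universe to their positions, and from positions
  to the new names. Injectivity on the union keeps distinct sets distinct and preserves disjointness
  in both directions.\<close>

lemma has_packing_image:
  assumes "inj_on f (\<Union>G)"
  shows "has_packing ((`) f ` G) k \<longleftrightarrow> has_packing G k"
proof -
  have inj: "inj_on ((`) f) G"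
    using assms by (intro inj_onI) (metis Union_upper inj_on_image_eq_iff)
  have dis: "disjnt (f ` S) (f ` T) \<longleftrightarrow> disjnt S T" if "S \<in> G" "T \<in> G" for S T
  proof -
    have "f ` (S \<inter> T) = f ` S \<inter> f ` T"
      using assms that by (intro inj_on_image_Int[of f "\<Union>G"]) auto
    then show ?thesis unfolding disjnt_def by (metis image_is_empty)
  qed
  have pw: "pairwise disjnt ((`) f ` Q) \<longleftrightarrow> pairwise disjnt Q" if "Q \<subseteq> G" for Q
  proof -
    have "f ` S = f ` T \<longleftrightarrow> S = T" if "S \<in> Q" "T \<in> Q" for S T
      using inj \<open>Q \<subseteq> G\<close> that by (meson inj_onD subsetD)
    then show ?thesis
      using dis that unfolding pairwise_def by (simp add: subset_iff)
  qed
  show ?thesis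
  proof
    assume "has_packing ((`) f ` G) k"
    then obtain P where P: "P \<subseteq> (`) f ` G" "finite P" "card P = k" "pairwise disjnt P"
      unfolding has_packing_def by auto
    then obtain Q where Q: "Q \<subseteq> G" "inj_on ((`) f) Q" "P = (`) f ` Q"
      unfolding subset_image_inj by auto
    then have "finite Q" "card Q = k" "pairwise disjnt Q"
      using P pw by (auto simp: card_image finite_image_iff)
    then show "has_packing G k" using Q(1) unfolding has_packing_def by auto
  next
    assume "has_packing G k"
    then obtain Q where Q: "Q \<subseteq> G" "finite Q" "card Q = k" "pairwise disjnt Q"
      unfolding has_packing_def by auto
    have "card ((`) f ` Q) = k"
      using card_image[OF inj_on_subset[OF inj Q(1)]] Q(3) by simp
    moreover have "pairwise disjnt ((`) f ` Q)" using pw[OF Q(1)] Q(4) by simp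
    moreover have "(`) f ` Q \<subseteq> (`) f ` G" using Q(1) by (rule image_mono)
    ultimately show "has_packing ((`) f ` G) k"
      using finite_imageI[OF Q(2)] unfolding has_packing_def by blast
  qed
qed


section \<open>Levels of the kernel\<close>

text \<open>The next level is defined from the counts in the previous one, so that membership can be
  recomputed instead of being stored.\<close>

fun keep :: "nat \<Rightarrow> nat \<Rightarrow> (nat \<Rightarrow> 'a set) \<Rightarrow> nat \<Rightarrow> nat \<Rightarrow> bool" where
  "keep d b A 0 j \<longleftrightarrow> True"
| "keep d b A (Suc l) j \<longleftrightarrow> keep d b A l j \<and>
     (\<forall>C\<subseteq>A j. card C = d - Suc l \<longrightarrow> card {i. i < j \<and> keep d b A l i \<and> C \<subseteq> A i} < b ^ Suc l)"

text \<open>Consider the last survivor containing \<open>C\<close>. It survived because fewer than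
  \<open>b ^ l\<close> earlier sets of the previous level contain \<open>C\<close>, and all other
  survivors containing \<open>C\<close> are among those. At level 0 a set of size at most
  \<open>d\<close> containing the \<open>d\<close> elements of \<open>C\<close> equals
  \<open>C\<close>.\<close>

lemma card_keep_superset_le:
  assumes A: "inj_on A {..<n}" "\<And>i. i < n \<Longrightarrow> finite (A i)" "\<And>i. i < n \<Longrightarrow> card (A i) \<le> d"
    and "card C = d - l" "finite C"
  shows "card {i. i < n \<and> keep d b A l i \<and> C \<subseteq> A i} \<le> b ^ l"
proof (cases l)
  case 0
  have "A i = C" if "i < n" "C \<subseteq> A i" for i
    using that A(2,3)[of i] assms(4) 0 card_seteq[of "A i" C] by simp
  then have "i = i'" if "i < n" "C \<subseteq> A i" "i' < n" "C \<subseteq> A i'" for i i'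
    using that A(1) by (metis inj_onD lessThan_iff)
  then have "card {i. i < n \<and> C \<subseteq> A i} \<le> Suc 0"
    by (subst card_le_Suc0_iff_eq) auto
  then show ?thesis using 0 by simp
next
  case (Suc m)
  let ?X = "{i. i < n \<and> keep d b A l i \<and> C \<subseteq> A i}"
  show ?thesis
  proof (cases "?X = {}")
    case False
    define j where "j = Max ?X"
    have j: "j \<in> ?X" "\<And>i. i \<in> ?X \<Longrightarrow> i \<le> j"
      using Max_in[of ?X] Max_ge[of ?X] False by (auto simp: j_def)
    have "?X - {j} \<subseteq> {i. i < j \<and> keep d b A m i \<and> C \<subseteq> A i}" (is "_ \<subseteq> ?Y")
      using j(2) Suc by (auto simp: le_less)
    then have "card (?X - {j}) \<le> card ?Y"
      by (intro card_mono) auto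
    moreover have "card ?Y < b ^ l"
      using j(1) assms(4) Suc by auto
    ultimately show ?thesis using j(1) by (subst (asm) card_Diff_singleton) auto
  qed (metis card.empty le0)
qed

text \<open>If a member of a packing is dropped, there are so many earlier sets containing \<open>C\<close> that one
  of them avoids the remaining members of the packing.  Dropping sets from the last to the first
  makes sure that the earlier sets are still present.\<close>

lemma has_packing_keep_Suc:
  assumes A: "inj_on A {..<n}" "\<And>i. i < n \<Longrightarrow> finite (A i)" "\<And>i. i < n \<Longrightarrow> card (A i) \<le> d"
    and "Suc l \<le> d" "b = d * (k - 1) + 1"
    and "has_packing (A ` {i. i < n \<and> keep d b A l i}) k"
  shows "has_packing (A ` {i. i < n \<and> keep d b A (Suc l) i}) k"
proof -
  \<comment> \<open>Hybrid families: positions below \<open>m\<close> are judged by level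
    \<open>l\<close>, the others by level \<open>Suc l\<close>. Passing from \<open>Suc m\<close> to
    \<open>m\<close> loses at most the set \<open>A m\<close>.\<close>
  define G where "G m = A ` {i. i < n \<and> keep d b A l i \<and> (i < m \<or> keep d b A (Suc l) i)}" for m
  have step: "has_packing (G m) k" if pack: "has_packing (G (Suc m)) k" for m
  proof (cases "m < n \<and> keep d b A l m \<and> \<not> keep d b A (Suc l) m")
    case False
    then have "G (Suc m) = G m" unfolding G_def less_Suc_eq by (intro arg_cong[of _ _ "(`) A"]) blast
    then show ?thesis using pack by simp
  next
    case True
    have G: "G (Suc m) \<subseteq> insert (A m) (G m)"
      unfolding G_def by (auto simp del: keep.simps simp: less_Suc_eq)
    obtain P where P: "P \<subseteq> G (Suc m)" "finite P" "card P = k" "pairwise disjnt P"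
      using pack unfolding has_packing_def by auto
    show ?thesis
    proof (cases "A m \<in> P")
      case False
      then have "P \<subseteq> G m" using P(1) G by auto
      then show ?thesis using P unfolding has_packing_def by auto
    next
      case Am: True
      obtain C where C: "C \<subseteq> A m" "card C = d - Suc l"
        "b ^ Suc l \<le> card {i. i < m \<and> keep d b A l i \<and> C \<subseteq> A i}" (is "_ \<le> card ?X")
        using True by (auto simp: not_less)
      have finC: "finite C" using C(1) A(2)[of m] True finite_subset by auto
      define P' where "P' = P - {A m}"
      define V where "V = \<Union>P'"
      \<comment> \<open>The empty set needs separate care: it is disjoint from everything, so a
        replacement could be an empty set that is already in \<open>P'\<close>, and the packing
        would lose a member. In return, an empty member contributes nothing to
        \<open>V\<close>.\<close>
      define e :: nat where "e = of_bool ({} \<in> P')"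
      have P': "finite P'" "card P' = k - 1" "pairwise disjnt P'" "\<And>S. S \<in> P' \<Longrightarrow> disjnt (A m) S"
        using P Am unfolding P'_def pairwise_def by auto
      have k: "k \<ge> 1" using P(2,3) Am card_gt_0_iff[of P] by auto
      have "P' \<subseteq> A ` {..<n}" using P(1) unfolding P'_def G_def by auto
      then have elem: "finite S \<and> card S \<le> d" if "S \<in> P'" for S
        using A that by auto
      have finV: "finite V" using P' elem by (auto simp: V_def)
      have cardV: "card V \<le> d * (k - 1 - e)"
      proof -
        have "V = \<Union>(P' - {{}})" by (auto simp: V_def)
        also have "card \<dots> \<le> (\<Sum>S\<in>P' - {{}}. card S)"
          by (rule card_Union_le_sum_card)
        also have "\<dots> \<le> card (P' - {{}}) * d"
          using elem sum_bounded_above[of "P' - {{}}" card d] by auto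
        also have "card (P' - {{}}) = k - 1 - e"
          using P' by (simp add: e_def card_Diff_singleton_if)
        finally show ?thesis by (simp add: mult.commute)
      qed
      \<comment> \<open>Indices that cannot serve as replacement: the set meets another member of
        the packing, or it is the empty set and already present.\<close>
      define Bad where "Bad = (\<Union>v\<in>V. {i. i < n \<and> keep d b A l i \<and> insert v C \<subseteq> A i}) \<union>
        {i. i < n \<and> A i = {} \<and> {} \<in> P'}"
      have "card (\<Union>v\<in>V. {i. i < n \<and> keep d b A l i \<and> insert v C \<subseteq> A i}) \<le> card V * b ^ l"
      proof -
        have "card {i. i < n \<and> keep d b A l i \<and> insert v C \<subseteq> A i} \<le> b ^ l" if "v \<in> V" for v
        proof (rule card_keep_superset_le[OF A])
          \<comment> \<open>Other members of the packing avoid \<open>A m\<close> and hence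
            \<open>C\<close>, so adding \<open>v\<close> raises the size to \<open>d - l\<close>,
            where level \<open>l\<close> has the bound \<open>b ^ l\<close>.\<close>
          have "v \<notin> C" using that P'(4) C(1) by (auto simp: V_def disjnt_def)
          then show "card (insert v C) = d - l" using finC C(2) assms(4) by simp
        qed (use finC in auto)
        then have "(\<Sum>v\<in>V. card {i. i < n \<and> keep d b A l i \<and> insert v C \<subseteq> A i}) \<le> card V * b ^ l"
          using sum_bounded_above[of V _ "b ^ l"] by auto
        with card_UN_le[OF finV] show ?thesis by (rule order_trans)
      qed
      moreover have "card {i. i < n \<and> A i = {} \<and> {} \<in> P'} \<le> e"
      proof (cases "{} \<in> P'")
        case True
        then have "card {i. i < n \<and> A i = {} \<and> {} \<in> P'} \<le> Suc 0"
          using A(1) by (subst card_le_Suc0_iff_eq) (auto simp: inj_on_def)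
        then show ?thesis using True by (simp add: e_def)
      qed auto
      ultimately have "card Bad \<le> card V * b ^ l + e"
        unfolding Bad_def using card_Un_le by (meson add_mono order_trans)
      also have "\<dots> \<le> d * (k - 1 - e) * b ^ l + e"
        using cardV by simp
      \<comment> \<open>If the empty set is a member, leaving it out of the count of elements saves
        \<open>d * b ^ l \<ge> 1\<close>, which pays for the one extra bad index.\<close>
      also have "\<dots> \<le> d * (k - 1) * b ^ l"
      proof (cases "{} \<in> P'")
        case True
        then have "k - 1 \<noteq> 0" using P'(1,2) by (metis card_eq_0_iff empty_iff)
        then obtain m where "k - 1 = Suc m" using not0_implies_Suc by blast
        moreover have "1 * 1 \<le> d * b ^ l" using assms(4,5) by (intro mult_mono) auto
        ultimately show ?thesis using True by (simp add: e_def add_mult_distrib)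
      qed (simp add: e_def)
      \<comment> \<open>The origin of \<open>b\<close>: it exceeds by 1 the largest possible number
        \<open>d * (k - 1)\<close> of elements in the other members.\<close>
      also have "\<dots> < b ^ Suc l" using assms(5) by simp
      finally have "card Bad < card ?X" using C(3) by linarith
      moreover have "finite Bad" unfolding Bad_def using finV by auto
      ultimately obtain i where i: "i \<in> ?X" "i \<notin> Bad"
        by (metis (no_types, lifting) card_mono linorder_not_le subsetI)
      have im: "i < n" using i True by auto
      have disV: "disjnt (A i) V"
        using i im unfolding Bad_def disjnt_def by blast
      have new: "A i \<notin> P'"
      proof
        assume *: "A i \<in> P'"
        \<comment> \<open>A member of \<open>P'\<close> is contained in \<open>V\<close>, so being
          disjoint from \<open>V\<close> forces it to be empty.\<close>
        then have "A i = {}" using disV unfolding V_def disjnt_def by blast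
        then show False using * i(2) im unfolding Bad_def by auto
      qed
      have "disjnt (A i) S" if "S \<in> P'" for S
        using disV that unfolding V_def disjnt_def by blast
      then have "pairwise disjnt (insert (A i) P')"
        using P'(3) by (auto simp: pairwise_insert disjnt_sym)
      moreover have "A i \<in> G m" unfolding G_def using i(1) im by (intro imageI) blast
      then have "insert (A i) P' \<subseteq> G m"
        using G P(1) unfolding P'_def by blast
      moreover have "card (insert (A i) P') = k" using P' new k by simp
      ultimately show ?thesis using P'(1) unfolding has_packing_def by blast
    qed
  qed
  have "A ` {i. i < n \<and> keep d b A l i} \<subseteq> G n" unfolding G_def by blast
  then have "has_packing (G n) k"
    using assms(6) has_packing_mono by blast
  then have "has_packing (G (n - m)) k" for m
  proof (induction m)
    case (Suc m)
    then show ?case using step[of "n - Suc m"]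
      by (cases "m < n") (auto simp: Suc_diff_Suc)
  qed auto
  moreover have "G 0 \<subseteq> A ` {i. i < n \<and> keep d b A (Suc l) i}" unfolding G_def by blast
  ultimately show ?thesis using has_packing_mono[of "G 0" k] by (metis diff_self_eq_0)
qed

lemma has_packing_keep_iff:
  assumes A: "inj_on A {..<n}" "\<And>i. i < n \<Longrightarrow> finite (A i)" "\<And>i. i < n \<Longrightarrow> card (A i) \<le> d"
  shows "has_packing (A ` {i. i < n \<and> keep d (d * (k - 1) + 1) A d i}) k \<longleftrightarrow> has_packing (A ` {..<n}) k"
proof
  assume "has_packing (A ` {..<n}) k"
  then have "l \<le> d \<Longrightarrow> has_packing (A ` {i. i < n \<and> keep d (d * (k - 1) + 1) A l i}) k" for l
  proof (induction l)
    case (Suc l)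
    then show ?case by (intro has_packing_keep_Suc[OF A]) auto
  qed (simp add: lessThan_def)
  then show "has_packing (A ` {i. i < n \<and> keep d (d * (k - 1) + 1) A d i}) k" by simp
qed (auto elim: has_packing_mono)

text \<open>At level \<open>d\<close> the set \<open>C\<close> has size 0, and every set contains
  the empty set.\<close>

lemma card_keep_le:
  assumes "inj_on A {..<n}" "\<And>i. i < n \<Longrightarrow> finite (A i)" "\<And>i. i < n \<Longrightarrow> card (A i) \<le> d"
  shows "card {i. i < n \<and> keep d b A d i} \<le> b ^ d"
  using card_keep_superset_le[OF assms, where C = "{}" and l = d and b = b] by simp


section \<open>Relabelling\<close>

definition rank :: "(nat \<Rightarrow> bool) \<Rightarrow> nat \<Rightarrow> nat" where
  "rank K j = length (filter K [0..<j])"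

lemma rank_simps [simp]: "rank K 0 = 0" "rank K (Suc j) = rank K j + of_bool (K j)"
  by (auto simp: rank_def)

lemma rank_mono: "i \<le> j \<Longrightarrow> rank K i \<le> rank K j"
  by (induction rule: dec_induct) auto

lemma rank_less: "K i \<Longrightarrow> i < j \<Longrightarrow> rank K i < rank K j"
  using rank_mono[of "Suc i" j K] by simp

lemma rank_inj: "K i \<Longrightarrow> K j \<Longrightarrow> rank K i = rank K j \<Longrightarrow> i = j"
  by (metis nat_neq_iff rank_less)

text \<open>The position of the last occurrence of \<open>e\<close> when every kept set gets \<open>d\<close> slots.\<close>

primrec label :: "nat \<Rightarrow> (nat \<Rightarrow> bool) \<Rightarrow> (nat \<Rightarrow> 'a list) \<Rightarrow> 'a \<Rightarrow> nat \<Rightarrow> nat" where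
  "label d K S e 0 = 0"
| "label d K S e (Suc j) = (if K j \<and> e \<in> set (S j)
     then d * rank K j + (THE i. i < length (S j) \<and> S j ! i = e) else label d K S e j)"

lemma the_index_eq:
  assumes "distinct xs" "i < length xs"
  shows "(THE j. j < length xs \<and> xs ! j = xs ! i) = i"
  using assms by (auto simp: nth_eq_iff_index_eq)

text \<open>Requiring an occurrence excludes the default value 0 of the base case, which would
  collide with the name of the very first slot.\<close>

lemma label_slot:
  assumes "\<exists>i<j. K i \<and> e \<in> set (S i)" "\<And>i. i < j \<Longrightarrow> distinct (S i)"
  shows "\<exists>i<j. \<exists>r<length (S i). K i \<and> S i ! r = e \<and> label d K S e j = d * rank K i + r"
  using assms
proof (induction j)
  case (Suc j)
  show ?case
  proof (cases "K j \<and> e \<in> set (S j)")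
    case True
    then obtain r where "r < length (S j)" "S j ! r = e" by (auto simp: in_set_conv_nth)
    then show ?thesis using True the_index_eq[of "S j" r] Suc.prems(2)[of j]
      by (intro exI[of _ j] conjI exI[of _ r]) auto
  next
    case False
    then have "\<exists>i<j. K i \<and> e \<in> set (S i)" using Suc.prems(1) by (auto simp: less_Suc_eq)
    then show ?thesis using Suc False by (metis label.simps(2) less_Suc_eq)
  qed
qed auto

lemma label_less:
  assumes "\<exists>i<j. K i \<and> e \<in> set (S i)" "\<And>i. i < j \<Longrightarrow> distinct (S i)"
    "\<And>i. i < j \<Longrightarrow> length (S i) \<le> d"
  shows "label d K S e j < d * rank K j"
proof -
  obtain i r where ir: "i < j" "r < length (S i)" "K i" "label d K S e j = d * rank K i + r"
    using label_slot[OF assms(1,2)] by blast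
  have "label d K S e j < d * Suc (rank K i)" using ir assms(3)[of i] by simp
  also have "\<dots> \<le> d * rank K j" using rank_less[of K i j] ir(1,3) by (intro mult_left_mono) auto
  finally show ?thesis .
qed

text \<open>Since the place \<open>r\<close> is below \<open>d\<close>, quotient and remainder by
  \<open>d\<close> recover the rank and the place. The rank determines the kept set, and a slot
  holds one element.\<close>

lemma label_inj:
  assumes "\<And>i. i < j \<Longrightarrow> distinct (S i)" "\<And>i. i < j \<Longrightarrow> length (S i) \<le> d"
  shows "inj_on (\<lambda>e. label d K S e j) {e. \<exists>i<j. K i \<and> e \<in> set (S i)}"
proof (rule inj_onI)
  fix e e'
  assume "e \<in> {e. \<exists>i<j. K i \<and> e \<in> set (S i)}" "e' \<in> {e. \<exists>i<j. K i \<and> e \<in> set (S i)}"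
    and eq: "label d K S e j = label d K S e' j"
  then obtain i r i' r' where
    ir: "i < j" "r < length (S i)" "K i" "S i ! r = e" "label d K S e j = d * rank K i + r" and
    ir': "i' < j" "r' < length (S i')" "K i'" "S i' ! r' = e'" "label d K S e' j = d * rank K i' + r'"
    using label_slot[of j K e S d] label_slot[of j K e' S d] assms(1) by blast
  have "r < d" "r' < d" using ir ir' assms(2)[of i] assms(2)[of i'] by auto
  moreover have "d * rank K i + r = d * rank K i' + r'" using eq ir ir' by simp
  ultimately have "rank K i = rank K i'" "r = r'"
    by (metis add.right_neutral div_less div_mult_self4 gr_implies_not0 add.commute)
       (use \<open>r < d\<close> \<open>r' < d\<close> \<open>d * rank K i + r = d * rank K i' + r'\<close> in
         \<open>metis mod_less mod_mult_self4\<close>)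
  then show "e = e'" using ir ir' rank_inj[of K i i'] by auto
qed


section \<open>The kernelization program\<close>

datatype var = VK | VBase | VB | VM | VN | VSlot | VLab | VJ
  | VPow nat | VP nat | VR nat | VC nat

instance var :: countable
  by countable_datatype

definition seqs :: "'v com list \<Rightarrow> 'v com" where
  "seqs cs = foldr Seq cs Skip"

lemma sem_seqs_Nil [simp]: "sem w n (seqs []) s = s"
  by (simp add: seqs_def)

lemma sem_seqs_Cons [simp]: "sem w n (seqs (c # cs)) s = sem w n (seqs cs) (sem w n c s)"
  by (simp add: seqs_def)

lemma sem_seqs_append [simp]:
  "sem w n (seqs (cs @ cs')) s = sem w n (seqs cs') (sem w n (seqs cs) s)"
  by (induction cs arbitrary: s) auto

lemma degree_seqs: "(\<And>c. c \<in> set cs \<Longrightarrow> degree c \<le> m) \<Longrightarrow> degree (seqs cs) \<le> m"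
  by (induction cs) (auto simp: seqs_def)

lemma degree_seqs_0: "(\<And>c. c \<in> set cs \<Longrightarrow> degree c = 0) \<Longrightarrow> degree (seqs cs) = 0"
  using degree_seqs[of cs 0] by simp

definition conj :: "'v bexp list \<Rightarrow> 'v bexp" where
  "conj bs = foldr BAnd bs (Less (Num 0) (Num 1))"

definition disj :: "'v bexp list \<Rightarrow> 'v bexp" where
  "disj bs = BNot (conj (map BNot bs))"

definition eq :: "'v exp \<Rightarrow> 'v exp \<Rightarrow> 'v bexp" where
  "eq e e' = BAnd (BNot (Less e e')) (BNot (Less e' e))"

lemma bval_conj [simp]: "bval w (conj bs) v \<longleftrightarrow> (\<forall>b\<in>set bs. bval w b v)"
  by (induction bs) (auto simp: conj_def)

lemma bval_disj [simp]: "bval w (disj bs) v \<longleftrightarrow> (\<exists>b\<in>set bs. bval w b v)"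
  by (auto simp: disj_def)

lemma bval_eq [simp]: "bval w (eq e e') v \<longleftrightarrow> aval w e v = aval w e' v"
  by (auto simp: eq_def)

text \<open>A pointer to the length field of a set is moved to the next set.  Adding the length by
  a cascade of tests keeps all increments equal to 1.\<close>

fun advance :: "nat \<Rightarrow> nat \<Rightarrow> 'v \<Rightarrow> 'v com" where
  "advance 0 i x = Set x (Plus x (Suc i))"
| "advance (Suc m) i x =
     If (Less (Num i) (Rd x 0)) (advance m (Suc i) x) (Set x (Plus x (Suc i)))"

lemma sem_advance:
  assumes "i \<le> fetch w (fst s x)" "fetch w (fst s x) \<le> i + m"
  shows "sem w n (advance m i x) s = ((fst s)(x := fst s x + Suc (fetch w (fst s x))), snd s)"
  using assms by (induction m arbitrary: i) auto

lemma degree_advance [simp]: "degree (advance m i x) = 0"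
  by (induction m arbitrary: i) auto

section \<open>Membership test and output passes as loop programs\<close>

definition foreach :: "nat \<Rightarrow> var \<Rightarrow> var com \<Rightarrow> var com" where
  "foreach d p c = Seq (Set p (Plus VBase 0)) (For (Seq c (advance d 0 p)))"

definition has_indices :: "nat list \<Rightarrow> var \<Rightarrow> var bexp" where
  "has_indices I p = conj (map (\<lambda>i. Less (Num i) (Rd p 0)) I)"

definition contains :: "nat \<Rightarrow> nat list \<Rightarrow> var \<Rightarrow> var \<Rightarrow> var bexp" where
  "contains d I p q = conj (map (\<lambda>i. disj (map (\<lambda>r.
     BAnd (Less (Num r) (Rd q 0)) (eq (Rd p (Suc i)) (Rd q (Suc r)))) [0..<d])) I)"

text \<open>A subset \<open>C\<close> of the current set is never stored. It is given by a list of
  places below \<open>d\<close>; there are constantly many such lists, and the program contains one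
  check for each.\<close>

definition index_sets :: "nat \<Rightarrow> nat \<Rightarrow> nat list list" where
  "index_sets d m = filter (\<lambda>I. length I = m) (subseqs [0..<d])"

text \<open>Pointers grow with the index of the set, so comparing \<open>VP l\<close> with
  \<open>VP (Suc l)\<close> restricts the count to preceding sets. The result can only be lowered,
  which lets the checks for all \<open>I\<close> be run in sequence as a conjunction.\<close>

definition check :: "nat \<Rightarrow> nat \<Rightarrow> var com \<Rightarrow> nat list \<Rightarrow> var com" where
  "check d l c I = If (has_indices I (VP (Suc l)))
     (Seq (Set (VC (Suc l)) (Num 0))
     (Seq (foreach d (VP l)
        (If (BAnd (Less (Plus (VP l) 0) (Plus (VP (Suc l)) 0)) (contains d I (VP (Suc l)) (VP l)))
           (Seq c (If (Less (Num 0) (Plus (VR l) 0)) (Set (VC (Suc l)) (Plus (VC (Suc l)) 1)) Skip))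
           Skip))
        (If (Less (Plus (VC (Suc l)) 0) (Plus (VPow (Suc l)) 0)) Skip (Set (VR (Suc l)) (Num 0)))))
     Skip"

fun keep_com :: "nat \<Rightarrow> nat \<Rightarrow> var com" where
  "keep_com d 0 = Set (VR 0) (Num 1)"
| "keep_com d (Suc l) = Seq (Set (VP l) (Plus (VP (Suc l)) 0)) (Seq (keep_com d l)
     (Seq (Set (VR (Suc l)) (Plus (VR l) 0))
       (seqs (map (check d l (keep_com d l)) (index_sets d (d - Suc l))))))"

definition kept_loop :: "nat \<Rightarrow> var com \<Rightarrow> var com" where
  "kept_loop d c = foreach d (VP d) (Seq (keep_com d d)
     (If (Less (Num 0) (Plus (VR d) 0)) c Skip))"

text \<open>A single pass suffices because every hit overwrites \<open>VLab\<close>. This is why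
  names refer to the last occurrence: nothing must be remembered about earlier hits.\<close>

definition label_com :: "nat \<Rightarrow> nat \<Rightarrow> var com" where
  "label_com d i = Seq (Set VSlot (Num 0)) (Seq (Set VLab (Num 0)) (Seq (kept_loop d
     (Seq (seqs (map (\<lambda>r. If (BAnd (Less (Num r) (Rd (VP d) 0))
        (eq (Rd (VP d) (Suc r)) (Rd VJ (Suc i)))) (Set VLab (Plus VSlot r)) Skip) [0..<d]))
     (Set VSlot (Plus VSlot d)))) (Out (Plus VLab 0))))"

definition count_com :: "nat \<Rightarrow> var com" where
  "count_com d = Seq (Set VM (Num 0)) (Seq (Set VN (Num 0))
     (kept_loop d (Seq (Set VN (Plus VN 1)) (Set VM (Plus VM d)))))"

text \<open>All loops have \<open>n\<close> iterations, so the \<open>d\<close> names belonging to a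
  kept set are written by unrolled code, whether or not they are in use.\<close>

definition universe_com :: "nat \<Rightarrow> var com" where
  "universe_com d = Seq (Out (Plus VM 0)) (Seq (Set VSlot (Num 0))
     (kept_loop d (Seq (seqs (map (\<lambda>r. Out (Plus VSlot r)) [0..<d])) (Set VSlot (Plus VSlot d)))))"

text \<open>The outer loop needs its own pointer \<open>VJ\<close>: the search in
  \<open>label_com\<close> moves \<open>VP d\<close> over the whole family.\<close>

definition family_com :: "nat \<Rightarrow> var com" where
  "family_com d = Seq (Out (Plus VN 0)) (foreach d VJ (Seq (Set (VP d) (Plus VJ 0))
     (Seq (keep_com d d) (If (Less (Num 0) (Plus (VR d) 0)) (Seq (Out (Rd VJ 0))
        (seqs (map (\<lambda>i. If (Less (Num i) (Rd VJ 0)) (label_com d i) Skip) [0..<d]))) Skip))))"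

definition kernel_com :: "nat \<Rightarrow> var com" where
  "kernel_com d = Seq (Out (Plus VK 0)) (Seq (count_com d) (Seq (universe_com d) (family_com d)))"

lemma degree_keep_com: "degree (keep_com d l) \<le> l"
proof (induction l)
  case (Suc l)
  have "degree (seqs (map (check d l (keep_com d l)) (index_sets d (d - Suc l)))) \<le> Suc l"
    using Suc by (intro degree_seqs) (auto simp: check_def foreach_def)
  then show ?case using Suc by simp
qed simp

text \<open>The exponent \<open>d + 2\<close> arises in \<open>family_com\<close>: a loop over the
  sets to be written, inside it the loop searching a name, and inside that the membership test with
  \<open>d\<close> nested loops.\<close>

lemma degree_kernel_com: "degree (kernel_com d) \<le> d + 2"
proof -
  have deg: "degree (kept_loop d c) \<le> Suc d" if "degree c = 0" for c
    using degree_keep_com[of d d] that by (simp add: kept_loop_def foreach_def)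
  have "degree (seqs (map (\<lambda>r. If (BAnd (Less (Num r) (Rd (VP d) 0))
      (eq (Rd (VP d) (Suc r)) (Rd VJ (Suc i)))) (Set VLab (Plus VSlot r)) Skip) [0..<d])) = 0" for i
    by (intro degree_seqs_0) auto
  then have "degree (label_com d i) \<le> Suc d" for i
    unfolding label_com_def using deg by simp
  then have "degree (seqs (map (\<lambda>i. If (Less (Num i) (Rd VJ 0)) (label_com d i) Skip) [0..<d])) \<le> Suc d"
    by (intro degree_seqs) auto
  then have "degree (family_com d) \<le> d + 2"
    using degree_keep_com[of d d] by (simp add: family_com_def foreach_def)
  moreover have "degree (seqs (map (\<lambda>r. Out (Plus VSlot r)) [0..<d])) = 0"
    by (intro degree_seqs_0) auto
  ultimately show ?thesis
    using deg by (simp add: kernel_com_def count_com_def universe_com_def le_SucI)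
qed

section \<open>Layout of the input\<close>

lemma fetch_append:
  "length xs = p \<Longrightarrow> i < length ys \<Longrightarrow> fetch (xs @ ys @ zs) (p + i) = ys ! i"
  by (auto simp: fetch_def nth_append)

text \<open>The program sees elements only as positions in the list of the universe, so the sets are
  sets of natural numbers below \<open>u\<close>.\<close>

locale set_family_encoding =
  fixes d k u :: nat and Ss :: "nat list list"
  assumes distinct_sets: "distinct (map set Ss)"
    and distinct_elems: "\<And>S. S \<in> set Ss \<Longrightarrow> distinct S"
    and length_le: "\<And>S. S \<in> set Ss \<Longrightarrow> length S \<le> d"
    and elems_less: "\<And>S. S \<in> set Ss \<Longrightarrow> set S \<subseteq> {..<u}"
begin

definition input :: "nat list" where
  "input = k # u # [0..<u] @ length Ss # concat (map (\<lambda>S. length S # S) Ss)"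

abbreviation n :: nat where "n \<equiv> length Ss"

definition b :: nat where "b = d * (k - 1) + 1"

text \<open>The offset \<open>u + 3\<close> covers the parameter, the size of the universe, its
  \<open>u\<close> words and the number of sets.\<close>

definition pos :: "nat \<Rightarrow> nat" where
  "pos j = u + 3 + (\<Sum>S\<leftarrow>take j Ss. Suc (length S))"

abbreviation A :: "nat \<Rightarrow> nat set" where "A j \<equiv> set (Ss ! j)"

abbreviation kept :: "nat \<Rightarrow> nat \<Rightarrow> bool" where "kept \<equiv> keep d b A"

lemma pos_Suc: "j < n \<Longrightarrow> pos (Suc j) = pos j + Suc (length (Ss ! j))"
  by (simp add: pos_def take_Suc_conv_app_nth)

lemma pos_less: "i < j \<Longrightarrow> j \<le> n \<Longrightarrow> pos i < pos j"
  by (induction j) (auto simp: pos_Suc less_Suc_eq)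

lemma pos_less_iff: "i < n \<Longrightarrow> j < n \<Longrightarrow> pos i < pos j \<longleftrightarrow> i < j"
  by (metis linorder_neqE_nat order_less_asym order_less_imp_le pos_less)

lemma fetch_set:
  assumes "j < n" "i \<le> length (Ss ! j)"
  shows "fetch input (pos j + i) = (length (Ss ! j) # Ss ! j) ! i"
proof -
  let ?e = "\<lambda>S. length S # S"
  let ?xs = "k # u # [0..<u] @ n # concat (map ?e (take j Ss))"
  have "Ss = take j Ss @ Ss ! j # drop (Suc j) Ss" using assms(1) by (rule id_take_nth_drop)
  then have "concat (map ?e Ss) = concat (map ?e (take j Ss @ Ss ! j # drop (Suc j) Ss))"
    by (rule arg_cong)
  also have "\<dots> = concat (map ?e (take j Ss)) @ ?e (Ss ! j) @
      concat (map ?e (drop (Suc j) Ss))"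
    by simp
  finally have "input = ?xs @ ?e (Ss ! j) @ concat (map ?e (drop (Suc j) Ss))"
    unfolding input_def by simp
  moreover have "length ?xs = pos j"
    by (simp add: pos_def length_concat comp_def)
  ultimately show ?thesis
    using assms(2) fetch_append[of ?xs "pos j" i "?e (Ss ! j)"] by simp
qed

lemma fetch_length: "j < n \<Longrightarrow> fetch input (pos j) = length (Ss ! j)"
  using fetch_set[of j 0] by simp

lemma fetch_elem: "j < n \<Longrightarrow> i < length (Ss ! j) \<Longrightarrow> fetch input (Suc (pos j + i)) = Ss ! j ! i"
  using fetch_set[of j "Suc i"] by simp

lemma set_length_le: "j < n \<Longrightarrow> length (Ss ! j) \<le> d"
  using length_le by simp

lemma set_distinct: "j < n \<Longrightarrow> distinct (Ss ! j)"
  using distinct_elems by simp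

lemma A_props: "inj_on A {..<n}" "\<And>i. i < n \<Longrightarrow> finite (A i)" "\<And>i. i < n \<Longrightarrow> card (A i) \<le> d"
  using distinct_sets order_trans[OF card_length set_length_le]
  by (auto simp: inj_on_def distinct_conv_nth)

definition initialized :: "(var \<Rightarrow> nat) \<Rightarrow> bool" where
  "initialized v \<longleftrightarrow> v VK = k \<and> v VBase = pos 0 \<and> (\<forall>l\<le>d. v (VPow l) = b ^ l)"

text \<open>The invariant is stated with the pointer already at the next set. The body must leave
  the pointer where it was, since advancing reads the length stored there.\<close>

lemma foreach_rule:
  assumes "v VBase = pos 0" "I 0 (v(p := pos 0)) out"
    and "\<And>j v out. j < n \<Longrightarrow> v p = pos j \<Longrightarrow> I j v out \<Longrightarrow>
      \<exists>v' out'. sem input n c (v, out) = (v', out') \<and> v' p = pos j \<and>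
        I (Suc j) (v'(p := pos (Suc j))) out'"
  shows "\<exists>v' out'. sem input n (foreach d p c) (v, out) = (v', out') \<and> I n v' out'"
proof -
  let ?c = "sem input n (Seq c (advance d 0 p))"
  have "\<exists>v' out'. (?c ^^ j) (v(p := pos 0), out) = (v', out') \<and> v' p = pos j \<and> I j v' out'"
    if "j \<le> n" for j using that
  proof (induction j)
    case (Suc j)
    then obtain v1 out1 where 1: "(?c ^^ j) (v(p := pos 0), out) = (v1, out1)" "v1 p = pos j"
      "I j v1 out1" by (meson Suc_leD)
    then obtain v2 out2 where 2: "sem input n c (v1, out1) = (v2, out2)" "v2 p = pos j"
      "I (Suc j) (v2(p := pos (Suc j))) out2"
      using assms(3)[of j v1 out1] Suc.prems by auto
    have "sem input n (advance d 0 p) (v2, out2) = (v2(p := pos (Suc j)), out2)"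
      using 2(2) Suc.prems set_length_le[of j]
      by (subst sem_advance) (auto simp: fetch_length pos_Suc)
    then have "?c (v1, out1) = (v2(p := pos (Suc j)), out2)" using 2(1) by simp
    then have "(?c ^^ Suc j) (v(p := pos 0), out) = (v2(p := pos (Suc j)), out2)"
      using 1(1) by (simp only: funpow.simps o_apply)
    then show ?case using 2(3) by (metis fun_upd_same)
  qed (use assms(2) in auto)
  from this[of n] show ?thesis using assms(1) by (simp add: foreach_def) blast
qed

section \<open>Correctness of the membership test\<close>

lemma bval_has_indices:
  assumes "v p = pos j" "j < n"
  shows "bval input (has_indices I p) v \<longleftrightarrow> (\<forall>i\<in>set I. i < length (Ss ! j))"
  using assms by (simp add: has_indices_def fetch_length)

lemma bval_contains:
  assumes "v p = pos j" "v q = pos m" "j < n" "m < n" "\<forall>i\<in>set I. i < length (Ss ! j)"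
  shows "bval input (contains d I p q) v \<longleftrightarrow> (!) (Ss ! j) ` set I \<subseteq> A m"
proof -
  have "(\<exists>r\<in>{0..<d}. r < length (Ss ! m) \<and> Ss ! j ! i = fetch input (Suc (pos m + r))) \<longleftrightarrow>
      Ss ! j ! i \<in> A m" for i
    using set_length_le[OF assms(4)] fetch_elem[OF assms(4)]
    by (fastforce simp: in_set_conv_nth)
  then show ?thesis
    using assms by (auto simp: contains_def fetch_length fetch_elem)
qed

text \<open>The elements are listed without repetition, so choosing \<open>m\<close> elements
  amounts to choosing \<open>m\<close> places, and all places are below \<open>d\<close>.\<close>

lemma all_index_sets_iff:
  assumes "j < n"
  shows "(\<forall>I\<in>set (index_sets d m). (\<forall>i\<in>set I. i < length (Ss ! j)) \<longrightarrow> Q ((!) (Ss ! j) ` set I)) \<longleftrightarrow>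
    (\<forall>C\<subseteq>A j. card C = m \<longrightarrow> Q C)"
proof (intro iffI ballI allI impI)
  fix C assume *: "\<forall>I\<in>set (index_sets d m). (\<forall>i\<in>set I. i < length (Ss ! j)) \<longrightarrow>
      Q ((!) (Ss ! j) ` set I)" and C: "C \<subseteq> A j" "card C = m"
  define T where "T = {i. i < length (Ss ! j) \<and> Ss ! j ! i \<in> C}"
  have "\<exists>i<length (Ss ! j). Ss ! j ! i = e" if "e \<in> C" for e
    using that C(1) by (metis in_set_conv_nth subsetD)
  then have T: "(!) (Ss ! j) ` T = C" unfolding T_def by blast
  have "inj_on ((!) (Ss ! j)) T"
    using set_distinct[OF assms] by (auto simp: T_def inj_on_def nth_eq_iff_index_eq)
  then have card: "card T = m" using T C(2) card_image by force
  have "T \<subseteq> set [0..<d]" using set_length_le[OF assms] by (auto simp: T_def)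
  then have "T \<in> set ` set (subseqs [0..<d])" by (simp only: subseqs_powset Pow_iff)
  then obtain I where I: "I \<in> set (subseqs [0..<d])" "T = set I"
    by (elim imageE)
  have "distinct I" using subseqs_distinctD[OF I(1)] by simp
  then have "I \<in> set (index_sets d m)"
    using I card by (auto simp: index_sets_def distinct_card)
  moreover have "\<forall>i\<in>set I. i < length (Ss ! j)" using I(2) by (auto simp: T_def)
  ultimately show "Q C" using * T I(2) by auto
next
  fix I assume *: "\<forall>C\<subseteq>A j. card C = m \<longrightarrow> Q C" and I: "I \<in> set (index_sets d m)"
    "\<forall>i\<in>set I. i < length (Ss ! j)"
  have "distinct I" using I(1) subseqs_distinctD[of I "[0..<d]"] by (simp add: index_sets_def)
  moreover have "inj_on ((!) (Ss ! j)) (set I)"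
    using set_distinct[OF assms] I(2) by (auto simp: inj_on_def nth_eq_iff_index_eq)
  ultimately have "card ((!) (Ss ! j) ` set I) = m"
    using I(1) by (simp add: card_image distinct_card index_sets_def)
  moreover have "(!) (Ss ! j) ` set I \<subseteq> A j" using I(2) by auto
  ultimately show "Q ((!) (Ss ! j) ` set I)" using * by blast
qed

text \<open>The frame of the test for level \<open>l\<close>. Its argument \<open>VP l\<close> is
  excluded because callers use it as their loop pointer.\<close>

fun touched :: "nat \<Rightarrow> var \<Rightarrow> bool" where
  "touched l (VP m) \<longleftrightarrow> m < l"
| "touched l (VR m) \<longleftrightarrow> m \<le> l"
| "touched l (VC m) \<longleftrightarrow> m \<le> l"
| "touched l x \<longleftrightarrow> False"

lemma touched_mono: "touched l x \<Longrightarrow> touched (Suc l) x"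
  by (cases x) auto

definition keep_com_spec :: "nat \<Rightarrow> var com \<Rightarrow> bool" where
  "keep_com_spec l c \<longleftrightarrow> (\<forall>v out j. initialized v \<longrightarrow> j < n \<longrightarrow> v (VP l) = pos j \<longrightarrow>
     (\<exists>v'. sem input n c (v, out) = (v', out) \<and> v' (VR l) = of_bool (kept l j) \<and>
        (\<forall>x. \<not> touched l x \<longrightarrow> v' x = v x)))"

lemma card_less_Suc:
  "card {i. i < Suc m \<and> Q i} = card {i. i < m \<and> Q i} + of_bool (Q m)"
proof -
  have "{i. i < Suc m \<and> Q i} = {i. i < m \<and> Q i} \<union> (if Q m then {m} else {})"
    by (auto simp: less_Suc_eq)
  then show ?thesis by simp
qed

lemma check_correct:
  assumes c: "keep_com_spec l c" and "Suc l \<le> d"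
    and "initialized v" "j < n" "v (VP (Suc l)) = pos j" "v (VR (Suc l)) = of_bool X"
  shows "\<exists>v'. sem input n (check d l c I) (v, out) = (v', out) \<and>
    v' (VR (Suc l)) = of_bool (X \<and> ((\<forall>i\<in>set I. i < length (Ss ! j)) \<longrightarrow>
      card {i. i < j \<and> kept l i \<and> (!) (Ss ! j) ` set I \<subseteq> A i} < b ^ Suc l)) \<and>
    (\<forall>x. \<not> touched (Suc l) x \<longrightarrow> v' x = v x)"
proof (cases "\<forall>i\<in>set I. i < length (Ss ! j)")
  case False
  then show ?thesis using assms(4-) by (auto simp: check_def bval_has_indices)
next
  case True
  let ?C = "(!) (Ss ! j) ` set I"
  let ?v = "v(VC (Suc l) := 0)"
  \<comment> \<open>The recursive test of level \<open>l\<close> touches neither its argument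
    \<open>VP l\<close> nor \<open>VC (Suc l)\<close>, so pointer and running count survive
    it.\<close>
  define J where "J m v' out' \<longleftrightarrow> out' = out \<and>
    (\<forall>x. \<not> touched l x \<longrightarrow> x \<noteq> VP l \<longrightarrow> x \<noteq> VC (Suc l) \<longrightarrow> v' x = v x) \<and>
    v' (VC (Suc l)) = card {i. i < m \<and> i < j \<and> kept l i \<and> ?C \<subseteq> A i}" for m v' out'
  let ?body = "If (BAnd (Less (Plus (VP l) 0) (Plus (VP (Suc l)) 0)) (contains d I (VP (Suc l)) (VP l)))
     (Seq c (If (Less (Num 0) (Plus (VR l) 0)) (Set (VC (Suc l)) (Plus (VC (Suc l)) 1)) Skip)) Skip"
  have "\<exists>v' out'. sem input n (foreach d (VP l) ?body) (?v, out) = (v', out') \<and> J n v' out'"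
  proof (rule foreach_rule)
    show "?v VBase = pos 0" using assms(3) by (simp add: initialized_def)
    show "J 0 (?v(VP l := pos 0)) out" by (auto simp: J_def)
  next
    fix m v1 out1
    assume m: "m < n" "v1 (VP l) = pos m" and J: "J m v1 out1"
    have v1: "v1 (VP (Suc l)) = pos j" "initialized v1"
      using J assms(3,5) by (auto simp: J_def initialized_def)
    have cond: "bval input (BAnd (Less (Plus (VP l) 0) (Plus (VP (Suc l)) 0))
        (contains d I (VP (Suc l)) (VP l))) v1 \<longleftrightarrow> m < j \<and> ?C \<subseteq> A m"
      using m v1 assms(4) True by (simp add: bval_contains pos_less_iff)
    show "\<exists>v' out'. sem input n ?body (v1, out1) = (v', out') \<and> v' (VP l) = pos m \<and>
        J (Suc m) (v'(VP l := pos (Suc m))) out'"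
    proof (cases "m < j \<and> ?C \<subseteq> A m")
      case False
      then have "sem input n ?body (v1, out1) = (v1, out1)"
        by (simp only: sem.simps(1,5) fst_conv cond if_False)
      moreover have "J (Suc m) (v1(VP l := pos (Suc m))) out1"
        using J False by (auto simp: J_def card_less_Suc)
      ultimately show ?thesis using m(2) by blast
    next
      case T: True
      obtain v2 where v2: "sem input n c (v1, out1) = (v2, out1)" "v2 (VR l) = of_bool (kept l m)"
        "\<And>x. \<not> touched l x \<Longrightarrow> v2 x = v1 x"
        using c v1(2) m unfolding keep_com_spec_def by blast
      let ?v3 = "if kept l m then v2(VC (Suc l) := Suc (v2 (VC (Suc l)))) else v2"
      have "sem input n ?body (v1, out1) =
          sem input n (If (Less (Num 0) (Plus (VR l) 0)) (Set (VC (Suc l)) (Plus (VC (Suc l)) 1)) Skip) (v2, out1)"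
        by (simp only: sem.simps(4,5) fst_conv cond T v2(1) simp_thms if_True)
      then have "sem input n ?body (v1, out1) = (?v3, out1)" using v2(2) by simp
      moreover have "?v3 (VP l) = pos m" using v2(3)[of "VP l"] m(2) by simp
      moreover have "J (Suc m) (?v3(VP l := pos (Suc m))) out1"
        using J T v2(3) by (auto simp: J_def card_less_Suc)
      ultimately show ?thesis by blast
    qed
  qed
  then obtain v1 where v1: "sem input n (foreach d (VP l) ?body) (?v, out) = (v1, out)"
    "J n v1 out" by (auto simp: J_def)
  have eq: "{i. i < n \<and> i < j \<and> kept l i \<and> ?C \<subseteq> A i} = {i. i < j \<and> kept l i \<and> ?C \<subseteq> A i}"
    using assms(4) by auto
  have *: "v1 (VPow (Suc l)) = b ^ Suc l" "v1 (VR (Suc l)) = of_bool X"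
    "v1 (VC (Suc l)) = card {i. i < j \<and> kept l i \<and> ?C \<subseteq> A i}"
    using v1(2) assms(2,3,6) eq unfolding J_def initialized_def by auto
  have unchanged: "v1 x = v x" if "\<not> touched (Suc l) x" for x
  proof -
    have "x \<noteq> VP l" "x \<noteq> VC (Suc l)" "\<not> touched l x"
      using that touched_mono[of l x] by auto
    then show ?thesis using v1(2) unfolding J_def by blast
  qed
  let ?v2 = "if v1 (VC (Suc l)) < v1 (VPow (Suc l)) then v1 else v1(VR (Suc l) := 0)"
  have "bval input (has_indices I (VP (Suc l))) v"
    using True assms(4,5) by (simp add: bval_has_indices)
  then have "sem input n (check d l c I) (v, out) = (?v2, out)"
    using v1(1) unfolding check_def by simp
  moreover have "?v2 (VR (Suc l)) = of_bool (X \<and> ((\<forall>i\<in>set I. i < length (Ss ! j)) \<longrightarrow>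
      card {i. i < j \<and> kept l i \<and> ?C \<subseteq> A i} < b ^ Suc l))"
    using * True by simp
  moreover have "\<not> touched (Suc l) x \<longrightarrow> ?v2 x = v x" for x
    using unchanged by auto
  ultimately show ?thesis by blast
qed

lemma checks_correct:
  assumes c: "keep_com_spec l c" and "Suc l \<le> d"
    and "initialized v" "j < n" "v (VP (Suc l)) = pos j" "v (VR (Suc l)) = of_bool X"
  shows "\<exists>v'. sem input n (seqs (map (check d l c) Is)) (v, out) = (v', out) \<and>
    v' (VR (Suc l)) = of_bool (X \<and> (\<forall>I\<in>set Is. (\<forall>i\<in>set I. i < length (Ss ! j)) \<longrightarrow>
      card {i. i < j \<and> kept l i \<and> (!) (Ss ! j) ` set I \<subseteq> A i} < b ^ Suc l)) \<and>
    (\<forall>x. \<not> touched (Suc l) x \<longrightarrow> v' x = v x)"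
  using assms(3-)
proof (induction Is arbitrary: v X)
  case (Cons I Is)
  obtain v1 where v1: "sem input n (check d l c I) (v, out) = (v1, out)"
    "v1 (VR (Suc l)) = of_bool (X \<and> ((\<forall>i\<in>set I. i < length (Ss ! j)) \<longrightarrow>
      card {i. i < j \<and> kept l i \<and> (!) (Ss ! j) ` set I \<subseteq> A i} < b ^ Suc l))"
    "\<And>x. \<not> touched (Suc l) x \<Longrightarrow> v1 x = v x"
    using check_correct[OF c assms(2) Cons.prems] by blast
  have "initialized v1" "v1 (VP (Suc l)) = pos j"
    using v1(3) Cons.prems by (auto simp: initialized_def)
  from Cons.IH[OF this(1) Cons.prems(2) this(2) v1(2)] show ?case
    using v1(1,3) by (auto simp del: One_nat_def)
qed auto

lemma keep_com_correct: "l \<le> d \<Longrightarrow> keep_com_spec l (keep_com d l)"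
proof (induction l)
  case 0
  show ?case by (auto simp: keep_com_spec_def)
next
  case (Suc l)
  then have IH: "keep_com_spec l (keep_com d l)" by simp
  show ?case unfolding keep_com_spec_def
  proof (intro allI impI)
    fix v :: "var \<Rightarrow> nat" and out j
    assume v: "initialized v" "j < n" "v (VP (Suc l)) = pos j"
    let ?v = "v(VP l := pos j)"
    have "initialized ?v" using v(1) by (simp add: initialized_def)
    then obtain v1 where v1: "sem input n (keep_com d l) (?v, out) = (v1, out)"
      "v1 (VR l) = of_bool (kept l j)" "\<And>x. \<not> touched l x \<Longrightarrow> v1 x = ?v x"
      using IH[unfolded keep_com_spec_def, rule_format, of ?v j out] v(2) by auto
    let ?v2 = "v1(VR (Suc l) := of_bool (kept l j))"
    have "initialized ?v2" "?v2 (VP (Suc l)) = pos j" "?v2 (VR (Suc l)) = of_bool (kept l j)"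
      using v1(3) v by (auto simp: initialized_def)
    from checks_correct[OF IH Suc.prems this(1) v(2) this(2,3), of "index_sets d (d - Suc l)" out]
    obtain v3 where v3: "sem input n (seqs (map (check d l (keep_com d l))
        (index_sets d (d - Suc l)))) (?v2, out) = (v3, out)"
      "v3 (VR (Suc l)) = of_bool (kept l j \<and> (\<forall>I\<in>set (index_sets d (d - Suc l)).
        (\<forall>i\<in>set I. i < length (Ss ! j)) \<longrightarrow>
        card {i. i < j \<and> kept l i \<and> (!) (Ss ! j) ` set I \<subseteq> A i} < b ^ Suc l))"
      "\<And>x. \<not> touched (Suc l) x \<Longrightarrow> v3 x = ?v2 x"
      by blast
    have "v3 (VR (Suc l)) = of_bool (kept (Suc l) j)"
      using v3(2) all_index_sets_iff[OF v(2), of "d - Suc l"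
        "\<lambda>C. card {i. i < j \<and> kept l i \<and> C \<subseteq> A i} < b ^ Suc l"]
      by simp
    moreover have "v3 x = v x" if "\<not> touched (Suc l) x" for x
      using that v3(3)[of x] v1(3)[of x] touched_mono[of l x]
      by (cases "x = VP l"; cases "x = VR (Suc l)") auto
    moreover have "sem input n (keep_com d (Suc l)) (v, out) = (v3, out)"
      using v1(1,2) v3(1) v(3) by simp
    ultimately show "\<exists>v'. sem input n (keep_com d (Suc l)) (v, out) = (v', out) \<and>
        v' (VR (Suc l)) = of_bool (kept (Suc l) j) \<and> (\<forall>x. \<not> touched (Suc l) x \<longrightarrow> v' x = v x)"
      by blast
  qed
qed

section \<open>Loops over the kept sets\<close>

fun global :: "var \<Rightarrow> bool" where
  "global (VP m) \<longleftrightarrow> False"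
| "global (VR m) \<longleftrightarrow> False"
| "global (VC m) \<longleftrightarrow> False"
| "global x \<longleftrightarrow> True"

lemma global_not_touched: "global x \<Longrightarrow> \<not> touched l x"
  by (cases x) auto

lemma initialized_cong: "initialized v \<Longrightarrow> (\<And>x. global x \<Longrightarrow> v' x = v x) \<Longrightarrow> initialized v'"
  by (simp add: initialized_def)

text \<open>The premise \<open>cong\<close> says that the invariant depends on global variables
  only. The membership test changes none of these, so it disappears from proofs that use this
  rule.\<close>

lemma kept_loop_rule:
  assumes "initialized v" "I 0 v out"
    and cong: "\<And>j v v' out. I j v out \<Longrightarrow> (\<And>x. global x \<Longrightarrow> v' x = v x) \<Longrightarrow> I j v' out"
    and skip: "\<And>j v out. j < n \<Longrightarrow> \<not> kept d j \<Longrightarrow> I j v out \<Longrightarrow> I (Suc j) v out"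
    and body: "\<And>j v out. j < n \<Longrightarrow> kept d j \<Longrightarrow> initialized v \<Longrightarrow> v (VP d) = pos j \<Longrightarrow> I j v out \<Longrightarrow>
      \<exists>v' out'. sem input n c (v, out) = (v', out') \<and> initialized v' \<and> v' (VP d) = pos j \<and>
        I (Suc j) v' out'"
  shows "\<exists>v' out'. sem input n (kept_loop d c) (v, out) = (v', out') \<and> initialized v' \<and> I n v' out'"
proof -
  define J where "J j v out \<longleftrightarrow> initialized v \<and> I j v out" for j v out
  have J_upd: "J j (v(VP d := p)) out" if "J j v out" for j v p out
  proof -
    have "(v(VP d := p)) x = v x" if "global x" for x
      using that by auto
    then show ?thesis
      using that cong[of j v out "v(VP d := p)"] initialized_cong[of v "v(VP d := p)"]
      unfolding J_def by blast
  qed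
  let ?c = "Seq (keep_com d d) (If (Less (Num 0) (Plus (VR d) 0)) c Skip)"
  have "\<exists>v' out'. sem input n (foreach d (VP d) ?c) (v, out) = (v', out') \<and> J n v' out'"
  proof (rule foreach_rule)
    show "v VBase = pos 0" using assms(1) by (simp add: initialized_def)
    show "J 0 (v(VP d := pos 0)) out" using assms(1,2) by (intro J_upd) (simp add: J_def)
  next
    fix j v1 out1 assume j: "j < n" "v1 (VP d) = pos j" and J: "J j v1 out1"
    then have "initialized v1" by (simp add: J_def)
    then obtain v2 where v2: "sem input n (keep_com d d) (v1, out1) = (v2, out1)"
      "v2 (VR d) = of_bool (kept d j)" "\<And>x. \<not> touched d x \<Longrightarrow> v2 x = v1 x"
      using keep_com_correct[of d, unfolded keep_com_spec_def, rule_format, of v1 j out1] j by auto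
    have J2: "initialized v2" "I j v2 out1" "v2 (VP d) = pos j"
      using J cong[of j v1 out1 v2] initialized_cong[of v1 v2] v2(3) global_not_touched j(2)
      by (auto simp: J_def)
    have "\<exists>v' out'. sem input n ?c (v1, out1) = (v', out') \<and> v' (VP d) = pos j \<and> J (Suc j) v' out'"
    proof (cases "kept d j")
      case True
      then show ?thesis using body[OF j(1) True J2(1,3,2)] v2 by (auto simp: J_def)
    next
      case False
      then show ?thesis using skip[OF j(1) False J2(2)] J2 v2 by (auto simp: J_def)
    qed
    then show "\<exists>v' out'. sem input n ?c (v1, out1) = (v', out') \<and> v' (VP d) = pos j \<and>
        J (Suc j) (v'(VP d := pos (Suc j))) out'"
      using J_upd by blast
  qed
  then show ?thesis by (simp add: kept_loop_def J_def)
qed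

section \<open>New names and the written output\<close>

abbreviation rk :: "nat \<Rightarrow> nat" where "rk \<equiv> rank (kept d)"

abbreviation lab :: "nat \<Rightarrow> nat \<Rightarrow> nat" where "lab e \<equiv> label d (kept d) ((!) Ss) e"

text \<open>Stated for the first \<open>t\<close> of the \<open>d\<close> unrolled tests, for the
  sake of induction. At most one test succeeds because elements of a set are distinct, so the place
  is well defined.\<close>

lemma label_search:
  assumes "j < n" "i < length (Ss ! j)" "m < n" "v VJ = pos j" "v (VP d) = pos m" "t \<le> d"
  shows "sem input n (seqs (map (\<lambda>r. If (BAnd (Less (Num r) (Rd (VP d) 0))
        (eq (Rd (VP d) (Suc r)) (Rd VJ (Suc i)))) (Set VLab (Plus VSlot r)) Skip) [0..<t])) (v, out) =
    (v(VLab := if \<exists>r<t. r < length (Ss ! m) \<and> Ss ! m ! r = Ss ! j ! i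
       then v VSlot + (THE r. r < length (Ss ! m) \<and> Ss ! m ! r = Ss ! j ! i) else v VLab), out)"
  using assms(6)
proof (induction t)
  case (Suc t)
  let ?Q = "\<lambda>r. r < length (Ss ! m) \<and> Ss ! m ! r = Ss ! j ! i"
  have the: "(THE r. ?Q r) = t" if "?Q t"
    using that the_index_eq[OF set_distinct[OF assms(3)], of t] by auto
  show ?case
    using Suc assms(1-5) the by (auto simp: fetch_length fetch_elem less_Suc_eq)
qed simp

lemma label_com_correct:
  assumes "initialized v" "j < n" "i < length (Ss ! j)" "v VJ = pos j"
  shows "\<exists>v'. sem input n (label_com d i) (v, out) = (v', out @ [lab (Ss ! j ! i) n]) \<and>
    initialized v' \<and> v' VJ = pos j"
proof -
  let ?e = "Ss ! j ! i"
  let ?c = "Seq (seqs (map (\<lambda>r. If (BAnd (Less (Num r) (Rd (VP d) 0))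
        (eq (Rd (VP d) (Suc r)) (Rd VJ (Suc i)))) (Set VLab (Plus VSlot r)) Skip) [0..<d]))
     (Set VSlot (Plus VSlot d))"
  define I where "I m v' out' \<longleftrightarrow> out' = out \<and> v' VJ = pos j \<and> v' VSlot = d * rk m \<and>
    v' VLab = lab ?e m" for m and v' :: "var \<Rightarrow> nat" and out'
  have "\<exists>v' out'. sem input n (kept_loop d ?c) (v(VSlot := 0, VLab := 0), out) = (v', out') \<and>
      initialized v' \<and> I n v' out'"
  proof (rule kept_loop_rule)
    fix m v1 out1
    assume m: "m < n" "kept d m" "initialized v1" "v1 (VP d) = pos m" and I: "I m v1 out1"
    have ex: "(\<exists>r<d. r < length (Ss ! m) \<and> Ss ! m ! r = ?e) \<longleftrightarrow> ?e \<in> A m"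
      using set_length_le[OF m(1)] by (auto simp: in_set_conv_nth intro: less_le_trans)
    show "\<exists>v' out'. sem input n ?c (v1, out1) = (v', out') \<and> initialized v' \<and> v' (VP d) = pos m \<and>
        I (Suc m) v' out'"
      using m I assms(2,3) ex by (simp add: label_search I_def) (simp add: initialized_def)
  qed (use assms in \<open>auto simp: I_def initialized_def\<close>)
  then show ?thesis by (auto simp: label_com_def I_def)
qed

lemma count_com_correct:
  assumes "initialized v"
  shows "\<exists>v'. sem input n (count_com d) (v, out) = (v', out) \<and> initialized v' \<and>
    v' VN = rk n \<and> v' VM = d * rk n"
proof -
  define I where "I m v' out' \<longleftrightarrow> out' = out \<and> v' VN = rk m \<and> v' VM = d * rk m"
    for m and v' :: "var \<Rightarrow> nat" and out'
  have "\<exists>v' out'. sem input n (kept_loop d (Seq (Set VN (Plus VN 1)) (Set VM (Plus VM d))))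
      (v(VM := 0, VN := 0), out) = (v', out') \<and> initialized v' \<and> I n v' out'"
    by (rule kept_loop_rule) (use assms in \<open>auto simp: I_def initialized_def\<close>)
  then show ?thesis by (auto simp: count_com_def I_def)
qed

lemma sem_outs: "sem w m (seqs (map (\<lambda>r. Out (Plus x r)) rs)) (v, out) = (v, out @ map (\<lambda>r. r + v x) rs)"
  by (induction rs arbitrary: out) auto

lemma universe_com_correct:
  assumes "initialized v" "v VM = d * rk n" "v VN = N"
  shows "\<exists>v'. sem input n (universe_com d) (v, out) = (v', out @ d * rk n # [0..<d * rk n]) \<and>
    initialized v' \<and> v' VN = N"
proof -
  let ?out = "out @ [d * rk n]"
  define I where "I m v' out' \<longleftrightarrow> out' = ?out @ [0..<d * rk m] \<and> v' VN = N \<and> v' VSlot = d * rk m"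
    for m and v' :: "var \<Rightarrow> nat" and out'
  have upt: "[0..<d * a] @ map (\<lambda>r. r + d * a) [0..<d] = [0..<d + d * a]" for a
    using upt_add_eq_append[of 0 "d * a" d] map_add_upt[of "d * a" d]
    by (simp add: add.commute[of d])
  have "\<exists>v' out'. sem input n (kept_loop d (Seq (seqs (map (\<lambda>r. Out (Plus VSlot r)) [0..<d]))
      (Set VSlot (Plus VSlot d)))) (v(VSlot := 0), ?out) = (v', out') \<and> initialized v' \<and> I n v' out'"
    by (rule kept_loop_rule) (use assms upt in \<open>auto simp: I_def initialized_def sem_outs\<close>)
  then show ?thesis using assms(2) by (auto simp: universe_com_def I_def)
qed

definition output_set :: "nat \<Rightarrow> nat list" where
  "output_set j = map (\<lambda>e. lab e n) (Ss ! j)"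

lemma labels_correct:
  assumes "initialized v" "j < n" "v VJ = pos j" "t \<le> d"
  shows "\<exists>v'. sem input n (seqs (map (\<lambda>i. If (Less (Num i) (Rd VJ 0)) (label_com d i) Skip) [0..<t])) (v, out) =
      (v', out @ take t (output_set j)) \<and> initialized v' \<and> v' VJ = pos j"
  using assms(4)
proof (induction t)
  case 0
  then show ?case using assms by simp
next
  case (Suc t)
  then obtain v1 where v1: "sem input n (seqs (map (\<lambda>i. If (Less (Num i) (Rd VJ 0)) (label_com d i) Skip)
      [0..<t])) (v, out) = (v1, out @ take t (output_set j))" "initialized v1" "v1 VJ = pos j"
    by auto
  show ?case
  proof (cases "t < length (Ss ! j)")
    case True
    then show ?thesis
      using v1 label_com_correct[OF v1(2) assms(2) True v1(3), of "out @ take t (output_set j)"]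
        assms(2)
      by (auto simp: fetch_length take_Suc_conv_app_nth output_set_def)
  next
    case False
    then show ?thesis using v1 assms(2) by (auto simp: fetch_length output_set_def)
  qed
qed

lemma family_com_correct:
  assumes "initialized v" "v VN = rk n"
  shows "\<exists>v'. sem input n (family_com d) (v, out) = (v', out @ rk n #
    concat (map (\<lambda>S. length S # S) (map output_set (filter (kept d) [0..<n]))))"
proof -
  let ?out = "out @ [rk n]"
  define J where "J j v' out' \<longleftrightarrow> initialized v' \<and>
    out' = ?out @ concat (map (\<lambda>S. length S # S) (map output_set (filter (kept d) [0..<j])))"
    for j v' out'
  let ?c = "Seq (Set (VP d) (Plus VJ 0))
     (Seq (keep_com d d) (If (Less (Num 0) (Plus (VR d) 0)) (Seq (Out (Rd VJ 0))
        (seqs (map (\<lambda>i. If (Less (Num i) (Rd VJ 0)) (label_com d i) Skip) [0..<d]))) Skip))"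
  have J_upd: "J j (v'(VJ := p)) out'" if "J j v' out'" for j v' p out'
    using that by (auto simp: J_def initialized_def)
  have "\<exists>v' out'. sem input n (foreach d VJ ?c) (v, ?out) = (v', out') \<and> J n v' out'"
  proof (rule foreach_rule)
    show "v VBase = pos 0" using assms(1) by (simp add: initialized_def)
    show "J 0 (v(VJ := pos 0)) ?out" using assms(1) by (intro J_upd) (simp add: J_def)
  next
    fix j v1 out1 assume j: "j < n" "v1 VJ = pos j" and J: "J j v1 out1"
    let ?v1 = "v1(VP d := pos j)"
    have "initialized ?v1" using J by (simp add: J_def initialized_def)
    then obtain v2 where v2: "sem input n (keep_com d d) (?v1, out1) = (v2, out1)"
      "v2 (VR d) = of_bool (kept d j)" "\<And>x. \<not> touched d x \<Longrightarrow> v2 x = ?v1 x"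
      using keep_com_correct[of d, unfolded keep_com_spec_def, rule_format, of ?v1 j out1] j by auto
    have v2': "initialized v2" "v2 VJ = pos j"
      using \<open>initialized ?v1\<close> v2(3) j(2) by (auto simp: initialized_def)
    have "\<exists>v' out'. sem input n ?c (v1, out1) = (v', out') \<and> v' VJ = pos j \<and> J (Suc j) v' out'"
    proof (cases "kept d j")
      case False
      then show ?thesis using v2 v2' j J by (auto simp: J_def)
    next
      case True
      have "length (output_set j) \<le> d" using set_length_le[OF j(1)] by (simp add: output_set_def)
      then obtain v3 where "sem input n (seqs (map (\<lambda>i. If (Less (Num i) (Rd VJ 0)) (label_com d i) Skip)
          [0..<d])) (v2, out1 @ [length (Ss ! j)]) = (v3, (out1 @ [length (Ss ! j)]) @ output_set j)"
        "initialized v3" "v3 VJ = pos j"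
        using labels_correct[OF v2'(1) j(1) v2'(2), of d "out1 @ [length (Ss ! j)]"] by auto
      moreover have "length (output_set j) = length (Ss ! j)" by (simp add: output_set_def)
      ultimately show ?thesis using True v2 v2' j J by (auto simp: J_def fetch_length)
    qed
    then show "\<exists>v' out'. sem input n ?c (v1, out1) = (v', out') \<and> v' VJ = pos j \<and>
        J (Suc j) (v'(VJ := pos (Suc j))) out'"
      using J_upd by blast
  qed
  then show ?thesis using assms(2) by (auto simp: family_com_def J_def)
qed

definition kernel_output :: "nat list" where
  "kernel_output = d * rk n # [0..<d * rk n] @ rk n #
     concat (map (\<lambda>S. length S # S) (map output_set (filter (kept d) [0..<n])))"

lemma kernel_com_correct:
  assumes "initialized v"
  shows "\<exists>v'. sem input n (kernel_com d) (v, []) = (v', k # kernel_output)"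
proof -
  obtain v1 where v1: "sem input n (count_com d) (v, [k]) = (v1, [k])" "initialized v1"
    "v1 VN = rk n" "v1 VM = d * rk n"
    using count_com_correct[OF assms] by blast
  obtain v2 where v2: "sem input n (universe_com d) (v1, [k]) = (v2, [k] @ d * rk n # [0..<d * rk n])"
    "initialized v2" "v2 VN = rk n"
    using universe_com_correct[OF v1(2,4,3)] by blast
  obtain v3 where "sem input n (family_com d) (v2, [k] @ d * rk n # [0..<d * rk n]) = (v3,
      ([k] @ d * rk n # [0..<d * rk n]) @ rk n #
      concat (map (\<lambda>S. length S # S) (map output_set (filter (kept d) [0..<n]))))"
    using family_com_correct[OF v2(2,3)] by blast
  then show ?thesis
    using v1 v2 assms by (simp add: kernel_com_def kernel_output_def initialized_def)
qed

end


section \<open>Initialization\<close>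

fun straight :: "instr \<Rightarrow> bool" where
  "straight (Jump l) \<longleftrightarrow> False"
| "straight (Jump_less a b l) \<longleftrightarrow> False"
| "straight _ \<longleftrightarrow> True"

lemma straight_correct:
  assumes "code_at P (pc c) is" "\<forall>i\<in>set is. straight i"
  shows "steps_within P w (length is) c (fold (exec_instr w) is c) \<and>
    pc (fold (exec_instr w) is c) = pc c + length is"
  using assms
proof (induction "is" arbitrary: c)
  case (Cons i "is")
  have "pc (exec_instr w i c) = Suc (pc c)" using Cons.prems(2) by (cases i) auto
  then show ?case
    using Cons.IH[of "exec_instr w i c"] Cons.prems by (auto intro: steps_within_step)
qed (simp add: steps_within_refl)

text \<open>Register 3 is initially 0 and so addresses the parameter. The universe is skipped by
  computing \<open>u + 2\<close>, where the number of sets is stored; no time is spent on its words.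
  \<open>VM\<close> merely supplies the factor \<open>d\<close> here and is reset by
  \<open>count_com\<close>.\<close>

definition prelude_start :: "nat \<Rightarrow> program" where
  "prelude_start d = [Const 1 1, Read (reg VK) 3, Read (reg VBase) 1,
     Add (reg VBase) (reg VBase) 1, Add (reg VBase) (reg VBase) 1,
     Read 3 (reg VBase), Add (reg VBase) (reg VBase) 1,
     Sub (reg VB) (reg VK) 1, Const (reg VM) d, Mul (reg VB) (reg VB) (reg VM),
     Add (reg VB) (reg VB) 1, Const (reg (VPow 0)) 1]"

definition powers :: "nat \<Rightarrow> program" where
  "powers m = map (\<lambda>l. Mul (reg (VPow (Suc l))) (reg (VPow l)) (reg VB)) [0..<m]"

definition prelude :: "nat \<Rightarrow> program" where
  "prelude d = prelude_start d @ powers d"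

definition kernel_program :: "nat \<Rightarrow> program" where
  "kernel_program d = prelude d @ comp (length (prelude d)) 2 (kernel_com d)"

lemma fold_powers:
  assumes "regs c (reg (VPow 0)) = 1" "regs c (reg VB) = b"
  shows "(\<forall>l\<le>m. regs (fold (exec_instr w) (powers m) c) (reg (VPow l)) = b ^ l) \<and>
    (\<forall>r. (\<forall>l. r \<noteq> reg (VPow l)) \<longrightarrow> regs (fold (exec_instr w) (powers m) c) r = regs c r) \<and>
    out_tape (fold (exec_instr w) (powers m) c) = out_tape c"
proof (induction m)
  case (Suc m)
  have "fold (exec_instr w) (powers (Suc m)) c =
      exec_instr w (Mul (reg (VPow (Suc m))) (reg (VPow m)) (reg VB)) (fold (exec_instr w) (powers m) c)"
    by (simp add: powers_def)
  then show ?case using Suc assms(2) by (auto simp: le_Suc_eq)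
qed (use assms in \<open>auto simp: powers_def\<close>)

lemma incremental_kernel_program:
  "\<forall>q. length (prelude d) \<le> q \<longrightarrow> q < length (kernel_program d) \<longrightarrow>
     incremental (length (prelude d)) (kernel_program d ! q)"
proof (intro allI impI)
  fix q assume "length (prelude d) \<le> q" "q < length (kernel_program d)"
  then have "kernel_program d ! q \<in> set (comp (length (prelude d)) 2 (kernel_com d))"
    by (auto simp: kernel_program_def nth_append)
  then show "incremental (length (prelude d)) (kernel_program d ! q)"
    by (rule incremental_comp[rotated]) simp
qed

lemma steps_within_run:
  assumes "steps_within P w T init_config c" "halted P c" "T \<le> t"
  shows "run P w t = c"
proof -
  obtain t' where t': "t' \<le> T" "run P w t' = c"
    using assms(1) by (auto simp: steps_within_def run_def)
  then show ?thesis using halted_stays[of P w t' t] assms(2,3) by simp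
qed

context set_family_encoding
begin

lemma fetch_header: "fetch input 0 = k" "fetch input 1 = u" "fetch input (u + 2) = n"
proof -
  show "fetch input 0 = k" "fetch input 1 = u" by (simp_all add: fetch_def input_def)
  have "fetch ((k # u # [0..<u]) @ [n] @ concat (map (\<lambda>S. length S # S) Ss)) (u + 2 + 0) = [n] ! 0"
    by (intro fetch_append) auto
  then show "fetch input (u + 2) = n" by (simp add: input_def)
qed

lemma prelude_correct:
  assumes "code_at P 0 (prelude d)"
  shows "\<exists>c v. steps_within P input (length (prelude d)) init_config c \<and>
    pc c = length (prelude d) \<and> represents n (v, []) c \<and> initialized v"
proof -
  let ?a = "fold (exec_instr input) (prelude_start d) init_config"
  let ?c = "fold (exec_instr input) (prelude d) init_config"
  have exec_Read: "exec_instr w (Read r a) c =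
      c\<lparr>pc := pc c + 1, regs := (regs c)(r := fetch w (regs c a))\<rparr>" for w r a c
    by (simp add: fetch_def)
  have c0: "regs ?a 1 = 1" "regs ?a 3 = n" "out_tape ?a = []" "regs ?a (reg VK) = k"
    "regs ?a (reg VBase) = pos 0" "regs ?a (reg VB) = b" "regs ?a (reg (VPow 0)) = 1"
    using fetch_header
    by (simp_all add: prelude_start_def init_config_def exec_Read pos_def b_def mult.commute
        del: exec_instr.simps(6))
  have "\<forall>i\<in>set (prelude d). straight i"
    by (auto simp: prelude_def prelude_start_def powers_def)
  then have "steps_within P input (length (prelude d)) init_config ?c" "pc ?c = length (prelude d)"
    using straight_correct[of P init_config "prelude d" input] assms by (auto simp: init_config_def)
  moreover have "?c = fold (exec_instr input) (powers d) ?a" by (simp add: prelude_def)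
  then have "represents n (\<lambda>x. regs ?c (reg x), []) ?c" "initialized (\<lambda>x. regs ?c (reg x))"
    using fold_powers[OF c0(7,6), of d input] c0
    by (auto simp: represents_def initialized_def)
  ultimately show ?thesis by blast
qed

definition time :: nat where
  "time = length (prelude d) + com_time n (kernel_com d)"

lemma kernel_program_correct:
  "\<exists>c. steps_within (kernel_program d) input time init_config c \<and> halted (kernel_program d) c \<and>
     out_tape c = k # kernel_output"
proof -
  let ?P = "kernel_program d"
  have code: "code_at ?P 0 (prelude d)"
    "code_at ?P (length (prelude d)) (comp (length (prelude d)) 2 (kernel_com d))"
    using code_at_middle[of "[]" "prelude d"]
      code_at_middle[of "prelude d" "comp (length (prelude d)) 2 (kernel_com d)" "[]"]
    by (simp_all add: kernel_program_def)
  obtain c v where c: "steps_within ?P input (length (prelude d)) init_config c"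
    "pc c = length (prelude d)" "represents n (v, []) c" "initialized v"
    using prelude_correct[OF code(1)] by blast
  obtain c' where c': "steps_within ?P input (com_time n (kernel_com d)) c c'"
    "pc c' = length ?P" "represents n (sem input n (kernel_com d) (v, [])) c'"
    using comp_correct[of ?P c 2 "kernel_com d" n "(v, [])" input] code(2) c
    by (auto simp: kernel_program_def)
  obtain v' where "sem input n (kernel_com d) (v, []) = (v', k # kernel_output)"
    using kernel_com_correct[OF c(4)] by blast
  then have "out_tape c' = k # kernel_output" using c'(3) by (simp add: represents_def)
  then show ?thesis
    using steps_within_trans[OF c(1) c'(1)] c'(2) by (auto simp: time_def halted_def)
qed

lemma halts_within_kernel: "time \<le> t \<Longrightarrow> halts_within (kernel_program d) input t"
  using kernel_program_correct steps_within_run unfolding halts_within_def by metis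

lemma computes_kernel: "computes (kernel_program d) input (k # kernel_output)"
  using kernel_program_correct steps_within_run unfolding computes_def by (metis order_refl)

text \<open>Two phases: the prelude may square values a constant number of times, and the compiled
  part adds at most 1 per step.\<close>

lemma regs_bound:
  assumes m: "2 \<le> m" "\<forall>x\<in>set input. x \<le> m" "\<forall>r a. Const r a \<in> set (kernel_program d) \<longrightarrow> a \<le> m"
  shows "regs (run (kernel_program d) input t) r \<le> m ^ 2 ^ length (prelude d) + time"
proof -
  let ?P = "kernel_program d" and ?s = "length (prelude d)"
  have "code_at ?P 0 (prelude d)"
    using code_at_middle[of "[]" "prelude d"] by (simp add: kernel_program_def)
  then obtain c v where c: "steps_within ?P input ?s init_config c" "pc c = ?s" "represents n (v :: var \<Rightarrow> nat, []) c"
    using prelude_correct by blast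
  then obtain t1 where t1: "t1 \<le> ?s" "run ?P input t1 = c"
    by (auto simp: steps_within_def run_def)
  have pow: "m ^ 2 ^ t' \<le> m ^ 2 ^ ?s" if "t' \<le> ?s" for t'
    using that m(1) by (intro power_increasing) auto
  have early: "regs (run ?P input t') r \<le> m ^ 2 ^ ?s" if "t' \<le> ?s" for t' r
    using run_bound_power[OF m, of t' r] pow[OF that] by linarith
  have "regs (run ?P input t) r \<le> m ^ 2 ^ ?s + time" if "t \<le> time" for t
  proof (cases "t \<le> t1")
    case True
    then show ?thesis using early[of t r] t1(1) by simp
  next
    case False
    have m': "m \<le> m ^ 2 ^ ?s" using m(1) by (simp add: self_le_power)
    have "regs ((step ?P input ^^ (t - t1)) c) r \<le> m ^ 2 ^ ?s + (t - t1)"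
    proof (rule run_bound_incremental[OF incremental_kernel_program])
      show "regs c 1 = 1" using c(3) by (simp add: represents_def)
      show "\<forall>r. regs c r \<le> m ^ 2 ^ ?s" using early[OF t1(1)] t1(2) by simp
      show "\<forall>x\<in>set input. x \<le> m ^ 2 ^ ?s" using m(2) order_trans[OF _ m'] by blast
      show "\<forall>r a. Const r a \<in> set ?P \<longrightarrow> a \<le> m ^ 2 ^ ?s" using m(3) order_trans[OF _ m'] by blast
    qed (simp add: c(2))
    moreover have "run ?P input t = (step ?P input ^^ (t - t1)) c"
    proof -
      have "t = (t - t1) + t1" using False by simp
      then have "run ?P input t = (step ?P input ^^ ((t - t1) + t1)) init_config"
        unfolding run_def by (rule arg_cong)
      then show ?thesis using t1(2) unfolding run_def funpow_add o_apply by simp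
    qed
    ultimately show ?thesis using that by simp
  qed
  \<comment> \<open>After \<open>time\<close> steps the machine has halted, so longer runs reach no
    new configuration.\<close>
  moreover have "run ?P input t = run ?P input time" if "time \<le> t"
    using kernel_program_correct steps_within_run that by (metis order_refl)
  ultimately show ?thesis by (metis nle_le)
qed

end


section \<open>Sizes of instances\<close>

lemma bit_size_ge_1: "1 \<le> bit_size m"
  by (simp add: bit_size_def)

lemma less_power_bit_size: "m < 2 ^ bit_size m"
  using floorlog_leD[of 2 m "bit_size m"] by (simp add: bit_size_def)

lemma bit_size_le: "m < 2 ^ a \<Longrightarrow> 1 \<le> a \<Longrightarrow> bit_size m \<le> a"
  using floorlog_leI[of m 2 a] by (simp add: bit_size_def)

lemma bit_size_le_Suc: "bit_size m \<le> Suc m"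
  by (rule bit_size_le) (use less_exp[of "Suc m"] in linarith, simp)

lemma length_le_word_list_size: "length xs \<le> word_list_size xs"
  using sum_list_mono[of xs "\<lambda>_. 1" bit_size] bit_size_ge_1
  by (simp add: word_list_size_def sum_list_triv)

lemma word_list_size_le:
  assumes "\<And>x. x \<in> set xs \<Longrightarrow> x \<le> m"
  shows "word_list_size xs \<le> length xs * Suc m"
proof -
  have "word_list_size xs \<le> (\<Sum>x\<leftarrow>xs. Suc m)"
    unfolding word_list_size_def
    using assms by (intro sum_list_mono) (meson Suc_le_mono bit_size_le_Suc order_trans)
  then show ?thesis by (simp add: sum_list_triv)
qed

text \<open>Logarithms turn the power into a factor \<open>e\<close>. From
  \<open>a + z < 2 ^ a * 2 ^ bit_size z\<close> only additive constants remain, and these are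
  absorbed because \<open>bit_size z\<close> is at least 1.\<close>

lemma bit_size_power_le:
  assumes "m \<le> (a + z) ^ e"
  shows "bit_size m \<le> (e * a + e + 1) * bit_size z"
proof -
  have "a + z < (a + 1) * (z + 1)" by simp
  also have "\<dots> \<le> 2 ^ a * 2 ^ bit_size z"
    using Suc_leI[OF less_exp[of a]] Suc_leI[OF less_power_bit_size[of z]]
    unfolding Suc_eq_plus1 by (intro mult_mono) (assumption | simp only: le0)+
  finally have "(a + z) ^ e \<le> (2 ^ (a + bit_size z)) ^ e"
    by (intro power_mono) (simp_all add: power_add)
  also have "\<dots> < 2 ^ ((a + bit_size z) * e + 1)" by (simp add: power_mult)
  finally have "bit_size m \<le> (a + bit_size z) * e + 1"
    using assms by (intro bit_size_le) auto
  also have "\<dots> \<le> (a * bit_size z + bit_size z) * e + bit_size z"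
    using bit_size_ge_1[of z] by (intro add_mono mult_right_mono) auto
  finally show ?thesis by (simp add: algebra_simps)
qed

lemma space_le:
  assumes "\<And>r. regs c r \<le> (a + z) ^ e"
  shows "space P c \<le> card (\<Union>i\<in>set P. instr_regs i) * (e * a + e + 1) * bit_size z"
proof -
  have "space P c \<le> of_nat (card (\<Union>i\<in>set P. instr_regs i)) * ((e * a + e + 1) * bit_size z)"
    unfolding space_def using bit_size_power_le[OF assms] by (intro sum_bounded_above)
  then show ?thesis by (simp only: mult.assoc of_nat_id)
qed

lemma computable_power: "computable (\<lambda>k. a * (k + 1) ^ e)"
  unfolding computable_def
\<comment> \<open>Register 2 is never written, so it holds 0 and addresses the input word
  \<open>k\<close>.\<close>
proof (intro exI[of _ "[Const 1 1, Read 0 2, Add 0 0 1, Const 3 a] @ replicate e (Mul 3 3 0) @ [Write 3]"]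
    allI)
  fix k
  let ?is = "[Const 1 1, Read 0 2, Add 0 0 1, Const 3 a]"
  let ?P = "?is @ replicate e (Mul 3 3 0) @ [Write 3]"
  let ?c = "\<lambda>is. fold (exec_instr [k]) is init_config"
  have muls: "regs (fold (exec_instr [k]) (replicate e (Mul 3 3 0)) c) 3 = regs c 3 * regs c 0 ^ e \<and>
      out_tape (fold (exec_instr [k]) (replicate e (Mul 3 3 0)) c) = out_tape c" for c
    by (induction e arbitrary: c) auto
  have "regs (?c ?is) 0 = k + 1" "regs (?c ?is) 3 = a" "out_tape (?c ?is) = []"
    by (simp_all add: init_config_def)
  then have "out_tape (?c ?P) = [a * (k + 1) ^ e]"
    using muls[of "?c ?is"] by (simp del: fold_simps)
  moreover have "code_at ?P (pc init_config) ?P"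
    using code_at_middle[of "[]" ?P "[]"] by (simp add: init_config_def)
  then have *: "steps_within ?P [k] (length ?P) init_config (?c ?P)" "pc (?c ?P) = length ?P"
    using straight_correct[of ?P init_config ?P "[k]"] by (auto simp: init_config_def)
  moreover have "halted ?P (?c ?P)" using *(2) by (simp add: halted_def)
  ultimately show "computes ?P [k] [a * (k + 1) ^ e]"
    using steps_within_run[OF *(1)] unfolding computes_def by (metis order_refl)
qed

text \<open>With \<open>M = ((d + 1) * (k + 1)) ^ d\<close>, which bounds the number of kept sets
  since \<open>b \<le> (d + 1) * (k + 1)\<close>, the output has at most
  \<open>(2 * d + 3) * M\<close> words: two counts, \<open>d\<close> names and at most
  \<open>d + 1\<close> words for each kept set. The size of a word is at most
  \<open>(2 * d + 2) * M\<close>. The product yields \<open>(d + 1) ^ (2 * d)\<close>, and the final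
  1 pays for the parameter itself.\<close>

definition kernel_size_factor :: "nat \<Rightarrow> nat" where
  "kernel_size_factor d = (2 * d + 3) * (2 * d + 2) * (d + 1) ^ (2 * d) + 1"

context set_family_encoding
begin

text \<open>Apart from \<open>k\<close>, each word counts or indexes something that is itself listed
  in the encoding, so it is at most the number of words. For \<open>u\<close> this relies on the
  universe being written out.\<close>

lemma input_le:
  assumes "x \<in> set input"
  shows "x \<le> word_list_size (tl input) + k"
proof -
  have len: "length (tl input) = u + 2 + (\<Sum>S\<leftarrow>Ss. Suc (length S))"
    by (simp add: input_def length_concat comp_def)
  have S: "Suc (length S) \<le> (\<Sum>S\<leftarrow>Ss. Suc (length S))" if "S \<in> set Ss" for S
    using that by (intro member_le_sum_list) auto
  have n: "n \<le> (\<Sum>S\<leftarrow>Ss. Suc (length S))"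
    using sum_list_mono[of Ss "\<lambda>_. 1" "\<lambda>S. Suc (length S)"] by (simp add: sum_list_triv)
  have "x \<le> length (tl input) \<or> x = k"
    using assms n elems_less S unfolding len
    by (fastforce simp: input_def)
  then show ?thesis using length_le_word_list_size[of "tl input"] by auto
qed

lemma length_le_size: "n \<le> word_list_size (tl input)" "1 \<le> word_list_size (tl input)"
proof -
  have "n \<le> (\<Sum>S\<leftarrow>Ss. Suc (length S))"
    using sum_list_mono[of Ss "\<lambda>_. 1" "\<lambda>S. Suc (length S)"] by (simp add: sum_list_triv)
  then have "n \<le> length (tl input)" "1 \<le> length (tl input)"
    by (simp_all add: input_def length_concat comp_def)
  then show "n \<le> word_list_size (tl input)" "1 \<le> word_list_size (tl input)"
    using length_le_word_list_size[of "tl input"] by linarith+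
qed

lemma rk_eq_card: "rk n = card {i. i < n \<and> kept d i}"
proof -
  have "rk n = card (set (filter (kept d) [0..<n]))"
    unfolding rank_def by (intro distinct_card[symmetric]) simp
  also have "set (filter (kept d) [0..<n]) = {i. i < n \<and> kept d i}" by auto
  finally show ?thesis .
qed

lemma rk_le: "rk n \<le> b ^ d"
  unfolding rk_eq_card using A_props by (rule card_keep_le)

lemma kernel_output_size:
  "word_list_size kernel_output + k \<le> kernel_size_factor d * (k + 1) ^ (2 * d + 1)"
proof -
  let ?N = "rk n" and ?M = "((d + 1) * (k + 1)) ^ d"
  have "b \<le> (d + 1) * (k + 1)"
    unfolding b_def by (cases k) (auto simp: algebra_simps)
  then have N: "?N \<le> ?M" using rk_le power_mono[of b "(d + 1) * (k + 1)" d] by linarith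
  have N1: "1 \<le> ?M" by simp
  have outlen: "length (output_set j) = length (Ss ! j)" for j by (simp add: output_set_def)
  have lab: "lab e n < d * ?N" if "j < n" "kept d j" "e \<in> A j" for e j
    using that set_distinct set_length_le by (intro label_less) auto
  have sum: "(\<Sum>S\<leftarrow>map output_set (filter (kept d) [0..<n]). Suc (length S)) \<le> (d + 1) * ?N"
  proof -
    have "(\<Sum>S\<leftarrow>map output_set (filter (kept d) [0..<n]). Suc (length S)) \<le>
        (\<Sum>j\<leftarrow>filter (kept d) [0..<n]. d + 1)"
      unfolding map_map using set_length_le by (intro sum_list_mono) (auto simp: outlen)
    then show ?thesis by (simp add: sum_list_triv rank_def mult.commute)
  qed
  have len: "length kernel_output \<le> (2 * d + 3) * ?M"
  proof -
    have "length kernel_output = 2 + d * ?N +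
        (\<Sum>S\<leftarrow>map output_set (filter (kept d) [0..<n]). Suc (length S))"
      by (simp add: kernel_output_def length_concat comp_def)
    also have "\<dots> \<le> 2 * ?M + d * ?M + (d + 1) * ?M"
      using N N1 order_trans[OF sum mult_le_mono2[OF N]] mult_le_mono2[OF N, of d]
      by (intro add_mono) auto
    also have "\<dots> = (2 * d + 3) * ?M" by (simp add: algebra_simps)
    finally show ?thesis .
  qed
  have "x \<le> (d + 1) * ?N + d" if "x \<in> set kernel_output" for x
  proof -
    from that consider "x \<le> d * ?N" | "x = ?N" | j where "j < n" "kept d j" "x = length (Ss ! j)"
      | j e where "j < n" "kept d j" "e \<in> A j" "x = lab e n"
      unfolding kernel_output_def by (auto simp: outlen) (auto simp: output_set_def)
    then show ?thesis
    proof cases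
      case 3
      then show ?thesis using set_length_le[of j] by simp
    next
      case 4
      then show ?thesis using lab[of j e] by simp
    qed auto
  qed
  then have "word_list_size kernel_output \<le> length kernel_output * Suc ((d + 1) * ?N + d)"
    by (rule word_list_size_le)
  also have "\<dots> \<le> ((2 * d + 3) * ?M) * ((2 * d + 2) * ?M)"
  proof (rule mult_le_mono[OF len])
    have "Suc ((d + 1) * ?N + d) = (d + 1) * ?N + (d + 1) * 1" by simp
    also have "\<dots> \<le> (d + 1) * ?M + (d + 1) * ?M"
      using N N1 by (intro add_mono mult_le_mono2)
    also have "\<dots> = (2 * d + 2) * ?M" by (simp add: algebra_simps)
    finally show "Suc ((d + 1) * ?N + d) \<le> (2 * d + 2) * ?M" .
  qed
  also have "\<dots> = (2 * d + 3) * (2 * d + 2) * (d + 1) ^ (2 * d) * (k + 1) ^ (2 * d)"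
  proof -
    have "x ^ (2 * d) = x ^ d * x ^ d" for x :: nat by (simp add: mult_2 power_add)
    then show ?thesis by (simp only: power_mult_distrib ac_simps)
  qed
  also have "\<dots> \<le> (2 * d + 3) * (2 * d + 2) * (d + 1) ^ (2 * d) * (k + 1) ^ (2 * d + 1)"
    by (intro mult_le_mono2 power_increasing) auto
  finally have "word_list_size kernel_output \<le>
      (2 * d + 3) * (2 * d + 2) * (d + 1) ^ (2 * d) * (k + 1) ^ (2 * d + 1)" .
  moreover have "k \<le> 1 * (k + 1) ^ (2 * d + 1)"
    using self_le_power[of "k + 1" "2 * d + 1"] by simp
  ultimately show ?thesis unfolding kernel_size_factor_def add_mult_distrib by linarith
qed

section \<open>The output as an equivalent instance\<close>

definition output_universe :: "nat set" where
  "output_universe = {..<d * rk n}"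

definition output_family :: "nat set set" where
  "output_family = (`) (\<lambda>e. lab e n) ` (A ` {i. i < n \<and> kept d i})"

lemma inj_lab: "inj_on (\<lambda>e. lab e n) (\<Union>(A ` {i. i < n \<and> kept d i}))"
proof -
  have "inj_on (\<lambda>e. lab e n) {e. \<exists>i<n. kept d i \<and> e \<in> A i}"
    using set_distinct set_length_le by (intro label_inj) auto
  moreover have "\<Union>(A ` {i. i < n \<and> kept d i}) = {e. \<exists>i<n. kept d i \<and> e \<in> A i}" by auto
  ultimately show ?thesis by simp
qed

lemma output_family_instance: "((output_universe, output_family), k) \<in> instances (set_packing d)"
proof -
  have "lab e n < d * rk n" if "j < n" "kept d j" "e \<in> A j" for e j
    using that set_distinct set_length_le by (intro label_less) auto
  then have "output_family \<subseteq> Pow output_universe"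
    unfolding output_family_def output_universe_def by auto
  moreover have "card ((\<lambda>e. lab e n) ` A j) \<le> d" if "j < n" for j
    using card_image_le[of "A j"] A_props(3)[OF that] by (meson List.finite_set order_trans)
  ultimately show ?thesis
    by (auto simp: set_packing_def output_family_def output_universe_def)
qed

lemma card_output_family: "card output_family \<le> b ^ d"
proof -
  have "card output_family \<le> card {i. i < n \<and> kept d i}"
    unfolding output_family_def image_image by (intro card_image_le) auto
  then show ?thesis using rk_le rk_eq_card by simp
qed

lemma encodes_output_family: "encodes_set_family kernel_output (output_universe, output_family)"
proof -
  let ?us = "[0..<d * rk n]" and ?Ss = "map output_set (filter (kept d) [0..<n])"
  let ?f = "\<lambda>e. lab e n"
  have inj: "inj_on ?f (A j \<union> A j')" if "j < n" "kept d j" "j' < n" "kept d j'" for j j'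
    using that by (intro inj_on_subset[OF inj_lab]) auto
  have less: "set (output_set j) \<subseteq> {..<d * rk n}" if "j < n" "kept d j" for j
    using that set_distinct set_length_le label_less[of n "kept d" _ "(!) Ss" d]
    by (auto simp: output_set_def)
  have dist: "distinct (output_set j)" if "j < n" "kept d j" for j
    using that inj[OF that that] set_distinct by (simp add: output_set_def distinct_map)
  have dists: "distinct (map set ?Ss)"
  proof -
    have "j = j'" if "j < n" "kept d j" "j' < n" "kept d j'" "?f ` A j = ?f ` A j'" for j j'
    proof -
      have "A j = A j'"
        using inj_on_image_eq_iff[OF inj[OF that(1-4)], of "A j" "A j'"] that(5) by auto
      then show ?thesis using A_props(1) that(1,3) by (auto dest: inj_onD)
    qed
    then have "inj_on (\<lambda>j. ?f ` A j) {j. j < n \<and> kept d j}" by (intro inj_onI) auto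
    moreover have "set (filter (kept d) [0..<n]) = {j. j < n \<and> kept d j}" by auto
    ultimately show ?thesis
      by (simp add: distinct_map output_set_def comp_def)
  qed
  have fam: "output_family = (\<lambda>S. (!) ?us ` set S) ` set ?Ss"
  proof -
    \<comment> \<open>The output universe is listed in increasing order from 0, so each element is
      its own position.\<close>
    have "(!) ?us ` set (output_set j) = ?f ` A j" if "j < n" "kept d j" for j
    proof -
      have "(!) ?us ` set (output_set j) = (\<lambda>x. x) ` set (output_set j)"
        using less[OF that] by (intro image_cong) auto
      then show ?thesis by (simp add: output_set_def)
    qed
    then show ?thesis unfolding output_family_def by (auto simp: image_iff)
  qed
  have out: "kernel_output = length ?us # [0..<length ?us] @ length ?Ss #
      concat (map (\<lambda>S. length S # S) ?Ss)"
    by (simp add: kernel_output_def rank_def)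
  show ?thesis
    unfolding encodes_set_family_def prod.case
  proof (intro exI conjI)
    show "\<forall>S\<in>set ?Ss. distinct S \<and> set S \<subseteq> {..<length ?us}"
      using dist less by simp
    show "set ?us = output_universe" by (simp add: output_universe_def lessThan_atLeast0)
  qed (simp, fact dists, fact fam, fact out)
qed

lemma has_packing_output_family: "has_packing output_family k \<longleftrightarrow> has_packing (set ` set Ss) k"
proof -
  have "has_packing output_family k \<longleftrightarrow> has_packing (A ` {i. i < n \<and> kept d i}) k"
    unfolding output_family_def by (rule has_packing_image[OF inj_lab])
  also have "\<dots> \<longleftrightarrow> has_packing (A ` {..<n}) k"
    unfolding b_def by (rule has_packing_keep_iff[OF A_props])
  also have "A ` {..<n} = set ` set Ss"
    by (auto simp: set_conv_nth[of Ss])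
  finally show ?thesis .
qed

end

text \<open>The list of the universe is injective on positions, so replacing elements by positions
  changes neither packings nor sizes. That \<open>n\<close> equals \<open>card F\<close> turns time
  measured in loop iterations into time measured in |F|.\<close>

lemma set_packing_encoding:
  fixes U :: "'a set"
  assumes "((U, F), k) \<in> instances (set_packing d)" "encodes (set_packing d) x (U, F)"
  obtains u Ss where "set_family_encoding d u Ss" "k # x = set_family_encoding.input k u Ss"
    "card F = length Ss" "has_packing F k \<longleftrightarrow> has_packing (set ` set Ss) k"
proof -
  obtain us Ss where us: "distinct us" "set us = U"
    "\<forall>S\<in>set Ss. distinct S \<and> set S \<subseteq> {..<length us}" "distinct (map set Ss)"
    "F = (\<lambda>S. (!) us ` set S) ` set Ss"
    "x = length us # [0..<length us] @ length Ss # concat (map (\<lambda>S. length S # S) Ss)"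
    using assms(2) by (auto simp: set_packing_def encodes_set_family_def)
  have inj: "inj_on ((!) us) {..<length us}"
    using us(1) by (auto simp: inj_on_def nth_eq_iff_index_eq)
  have F: "F = (`) ((!) us) ` (set ` set Ss)" using us(5) by auto
  have sub: "\<Union>(set ` set Ss) \<subseteq> {..<length us}" using us(3) by auto
  have "length S \<le> d" if "S \<in> set Ss" for S
  proof -
    have "card ((!) us ` set S) \<le> d"
      using assms(1) that us(5) by (auto simp: set_packing_def)
    moreover have "inj_on ((!) us) (set S)" using us(3) that by (intro inj_on_subset[OF inj]) auto
    moreover have "distinct S" using us(3) that by blast
    ultimately show ?thesis by (simp add: card_image distinct_card)
  qed
  then interpret set_family_encoding d k "length us" Ss
    using us(3,4) by unfold_locales auto
  have "card F = card (set ` set Ss)"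
    unfolding F
  proof (rule card_image, rule inj_onI)
    fix S T assume "S \<in> set ` set Ss" "T \<in> set ` set Ss" "(!) us ` S = (!) us ` T"
    then show "S = T" using inj_on_image_eq_iff[OF inj, of S T] sub by blast
  qed
  also have "\<dots> = length Ss"
    using distinct_card[OF us(4)] by simp
  finally have "card F = length Ss" .
  moreover have "has_packing F k \<longleftrightarrow> has_packing (set ` set Ss) k"
    unfolding F by (rule has_packing_image[OF inj_on_subset[OF inj sub]])
  moreover have "k # x = input" by (simp add: input_def us(6))
  ultimately show ?thesis using that set_family_encoding_axioms by blast
qed

lemma kernel_time_bound:
  obtains C where "\<And>u Ss. set_family_encoding d u Ss \<Longrightarrow> set_family_encoding.time d Ss \<le> C * max 1 (length Ss) ^ (d + 2)"
proof -
  obtain K where K: "\<And>n. com_time n (kernel_com d) \<le> K * max 1 n ^ degree (kernel_com d)"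
    using com_time_le by blast
  have "length (prelude d) + com_time n (kernel_com d) \<le>
      (length (prelude d) + K) * max 1 n ^ (d + 2)" for n
  proof -
    have "K * max 1 n ^ degree (kernel_com d) \<le> K * max 1 n ^ (d + 2)"
      using degree_kernel_com by (intro mult_le_mono2 power_increasing) auto
    moreover have "length (prelude d) * 1 \<le> length (prelude d) * max 1 n ^ (d + 2)"
      by (intro mult_le_mono2 one_le_power) simp
    ultimately show ?thesis using K[of n] unfolding add_mult_distrib by linarith
  qed
  then show ?thesis by (intro that) (simp only: set_family_encoding.time_def)
qed

text \<open>The prelude contributes the exponent \<open>2 ^ length (prelude d)\<close> and the
  running time the exponent \<open>d + 2\<close>. Both terms are raised to a common power, and one
  more factor of the base absorbs \<open>1 + C\<close>.\<close>

lemma regs_bound_power: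
  assumes m: "2 \<le> K" "\<forall>r a. Const r a \<in> set (kernel_program d) \<longrightarrow> a \<le> K"
    and C: "\<And>u Ss. set_family_encoding d u Ss \<Longrightarrow>
      set_family_encoding.time d Ss \<le> C * max 1 (length Ss) ^ (d + 2)"
    and enc: "set_family_encoding d u Ss" "k # x = set_family_encoding.input k u Ss"
  shows "regs (run (kernel_program d) (k # x) t) r \<le>
    (K + C + 1 + (word_list_size x + k)) ^ (2 ^ length (prelude d) + d + 3)"
proof -
  interpret set_family_encoding d k u Ss by (fact enc(1))
  let ?z = "word_list_size x + k" and ?s = "2 ^ length (prelude d) :: nat"
  let ?b = "K + C + 1 + ?z"
  have x: "x = tl input" using enc(2) by (metis list.sel(3))
  have "regs (run (kernel_program d) input t) r \<le> (K + ?z) ^ ?s + time"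
    using m input_le x by (intro regs_bound) (auto intro: order_trans trans_le_add1 trans_le_add2)
  moreover have "(K + ?z) ^ ?s \<le> ?b ^ (?s + d + 2)"
  proof -
    have "(K + ?z) ^ ?s \<le> ?b ^ ?s" by (intro power_mono) auto
    also have "\<dots> \<le> ?b ^ (?s + d + 2)" by (intro power_increasing) auto
    finally show ?thesis .
  qed
  moreover have "time \<le> C * ?b ^ (?s + d + 2)"
  proof -
    have "max 1 n ^ (d + 2) \<le> ?b ^ (d + 2)"
      using length_le_size x by (intro power_mono) auto
    also have "\<dots> \<le> ?b ^ (?s + d + 2)" by (intro power_increasing) auto
    finally show ?thesis using C[OF enc(1)] mult_le_mono2 order_trans by blast
  qed
  ultimately have "regs (run (kernel_program d) input t) r \<le>
      ?b ^ (?s + d + 2) + C * ?b ^ (?s + d + 2)"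
    by linarith
  also have "\<dots> = (1 + C) * ?b ^ (?s + d + 2)" by (simp only: add_mult_distrib mult_1)
  also have "\<dots> \<le> ?b * ?b ^ (?s + d + 2)" by (intro mult_le_mono1) simp
  also have "\<dots> = ?b ^ Suc (?s + d + 2)" by (simp only: power_Suc)
  also have "Suc (?s + d + 2) = ?s + d + 3" by simp
  finally show ?thesis unfolding enc(2) .
qed

theorem theorem2:
  fixes d :: nat
  shows "\<exists>P. logspace_kernelization P (set_packing d :: (nat set \<times> nat set set) parameterized_problem) \<and>
     (\<exists>c. \<forall>(U :: nat set) F k x.
        ((U, F), k) \<in> instances (set_packing d) \<longrightarrow> encodes (set_packing d) x (U, F) \<longrightarrow>
        halts_within P (k # x) (c * (max 1 (card F)) ^ (d + 2)) \<and>
        (\<exists>(U' :: nat set) F' k' x'.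
           computes P (k # x) (k' # x') \<and>
           ((U', F'), k') \<in> instances (set_packing d) \<and>
           encodes (set_packing d) x' (U', F') \<and>
           (((U, F), k) \<in> yes_instances (set_packing d) \<longleftrightarrow>
            ((U', F'), k') \<in> yes_instances (set_packing d)) \<and>
           card F' \<le> (d * (k - 1) + 1) ^ d))"
proof -
  let ?P = "kernel_program d"
  let ?Q = "set_packing d :: (nat set \<times> nat set set) parameterized_problem"
  let ?g = "\<lambda>k. kernel_size_factor d * (k + 1) ^ (2 * d + 1)"
  obtain C where C: "\<And>u Ss. set_family_encoding d u Ss \<Longrightarrow>
      set_family_encoding.time d Ss \<le> C * max 1 (length Ss) ^ (d + 2)"
    using kernel_time_bound by blast
  \<comment> \<open>\<open>K\<close> bounds all constants in the program text; the 2 makes a sum of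
    two registers no larger than the square of the bound.\<close>
  define K where "K = Max (insert 2 ((\<lambda>i. case i of Const r a \<Rightarrow> a | _ \<Rightarrow> 0) ` set ?P))"
  have K: "2 \<le> K" "\<forall>r a. Const r a \<in> set ?P \<longrightarrow> a \<le> K"
    unfolding K_def by (intro Max_ge allI impI; force)+
  have yes: "((U, F), k) \<in> yes_instances ?Q \<longleftrightarrow> has_packing F k"
    if "((U, F), k) \<in> instances ?Q" for U F k
    using that by (simp add: set_packing_def)
  \<comment> \<open>The parameter is returned unchanged. The inequality for
    \<open>max 1 (card F)\<close> converts the bound in |F| into one polynomial in the input
    size.\<close>
  have kernel: "halts_within ?P (k # x) (C * max 1 (card F) ^ (d + 2)) \<and>
      max 1 (card F) \<le> word_list_size x + k \<and>
      (\<exists>U' F' x'. computes ?P (k # x) (k # x') \<and> ((U', F'), k) \<in> instances ?Q \<and>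
        encodes ?Q x' (U', F') \<and> word_list_size x' + k \<le> ?g k \<and>
        (((U, F), k) \<in> yes_instances ?Q \<longleftrightarrow> ((U', F'), k) \<in> yes_instances ?Q) \<and>
        card F' \<le> (d * (k - 1) + 1) ^ d)"
    if inst: "((U, F), k) \<in> instances ?Q" "encodes ?Q x (U, F)" for U F k x
  proof -
    obtain u Ss where enc: "set_family_encoding d u Ss" "k # x = set_family_encoding.input k u Ss"
      "card F = length Ss" "has_packing F k \<longleftrightarrow> has_packing (set ` set Ss) k"
      using set_packing_encoding[OF inst] by blast
    interpret set_family_encoding d k u Ss by (fact enc(1))
    have x: "x = tl input" using enc(2) by (metis list.sel(3))
    have "max 1 (card F) \<le> word_list_size x + k" using length_le_size x enc(3) by simp
    moreover have "encodes ?Q kernel_output (output_universe, output_family)"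
      using encodes_output_family by (simp add: set_packing_def)
    ultimately show ?thesis
      using halts_within_kernel[OF C[OF enc(1)]] computes_kernel output_family_instance
        kernel_output_size card_output_family has_packing_output_family
        yes[OF inst(1)] yes[OF output_family_instance] enc
      unfolding b_def by auto
  qed
  have "kernelization ?P ?Q"
    unfolding kernelization_def
  proof (rule exI[of _ ?g], rule exI[of _ C], rule exI[of _ "d + 2"], intro conjI allI impI)
    show "computable ?g" by (rule computable_power)
    fix i k x assume *: "(i, k) \<in> instances ?Q" "encodes ?Q x i"
    obtain U F where i: "i = (U, F)" by (cases i)
    note ker = kernel[OF *[unfolded i]]
    show "halts_within ?P (k # x) (C * (word_list_size x + k) ^ (d + 2) + C)"
    proof -
      have "C * max 1 (card F) ^ (d + 2) \<le> C * (word_list_size x + k) ^ (d + 2) + C"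
        using ker power_mono[of "max 1 (card F)" "word_list_size x + k" "d + 2"]
        by (intro trans_le_add1 mult_le_mono2) blast
      then show ?thesis
        using ker halted_stays unfolding halts_within_def by metis
    qed
    show "\<exists>i' k' x'. computes ?P (k # x) (k' # x') \<and> (i', k') \<in> instances ?Q \<and> encodes ?Q x' i' \<and>
        word_list_size x' + k' \<le> ?g k \<and>
        ((i, k) \<in> yes_instances ?Q \<longleftrightarrow> (i', k') \<in> yes_instances ?Q)"
      using ker unfolding i by blast
  qed
  moreover have "space ?P (run ?P (k # x) t) \<le> card (\<Union>i\<in>set ?P. instr_regs i) *
      ((2 ^ length (prelude d) + d + 3) * (K + C + 1) + (2 ^ length (prelude d) + d + 3) + 1) *
      bit_size (word_list_size x + k)"
    if inst: "(i, k) \<in> instances ?Q" "encodes ?Q x i" for i k x t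
  proof -
    obtain U F where i: "i = (U, F)" by (cases i)
    obtain u Ss where "set_family_encoding d u Ss" "k # x = set_family_encoding.input k u Ss"
      using set_packing_encoding[OF inst[unfolded i]] by blast
    then show ?thesis by (intro space_le regs_bound_power[OF K C])
  qed
  ultimately have "logspace_kernelization ?P ?Q"
    unfolding logspace_kernelization_def by blast
  then show ?thesis using kernel by blast
qed

end
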